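(* Let $p$ be a prime, $g\ge1$ an integer, $q=p^g$ and $G=GL_2(\mathbb{F}_q)$. Using the families of identities in $K_0(G)$ $$(\Delta_g)\quad M_k=-e^{1+k}M_{-k-2}\qquad(k\in\mathbb{Z}),$$ $$(\Phi_g)\quad M_k=M_{k-p}M_1^{[1]}-e^pM_{k-2p}\qquad(k\in\mathbb{Z}),$$ $$(\Pi_g)\quad M_nM_m=M_{n+m}+e\,M_{n-1}M_{m-1}\qquad(n,m\in\mathbb{Z}),$$ one can compute the Jordan–Hölder factors in the standard form for any algebraic sum of products of virtual representations of the form $e^m\prod_{i=0}^{g-1}M_{k_i}^{[i]}$ with $m,k_0,\dots,k_{g-1}\in\mathbb{Z}$.
   Context: $K_0(G)$ is the Grothendieck group of finitely generated $\mathbb{F}_q[G]$-modules, a commutative ring with product induced by tensor product over $\mathbb{F}_q$; $e$ denotes the class of the determinant character. For $k\ge0$, $M_k$ is (the class of) $\mathrm{Sym}^k\mathbb{F}_q^2$; $M_{-1}=0$ and $M_k=-e^{1+k}M_{-k-2}$ for $k\le-2$. For $n\in\mathbb{Z}$, $[n]$ denotes the $n$-th Frobenius twist: the $G$-action is precomposed with the automorphism applying the $n$-th power of the Frobenius $\sigma:x\mapsto x^p$ to matrix entries; it is a ring automorphism of $K_0(G)$ with $e^{[n]}=e^{p^n}$. Computability in the standard form. Let $M\in K_0(G)$ be given as an algebraic sum of products of elements of the form $e^{m}\prod_{i=0}^{g-1}M_{k_i}^{[i]}$ with $m,k_0,\dots,k_{g-1}\in\mathbb{Z}$. One says that the Jordan–Hölder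 factors of $M$ can be computed in the standard form using a given collection of families of identities if, by applying finitely many times these identities (to factors, including Frobenius-twisted factors, of the products involved), together with the identities $e^{q-1}=1$ and $\sigma^g=1$ (i.e. $N^{[n+g]}=N^{[n]}$ for all $N$ and $n$), one can write $$M=\sum_{j\in J}n_j\Big(e^{m_j}\prod_{i=0}^{g-1}M_{k_i^{(j)}}^{[i]}\Big)$$ where $J$ is a finite set and, for each $j\in J$, $n_j,m_j,k_0^{(j)},\dots,k_{g-1}^{(j)}\in\mathbb{Z}$ satisfy $n_j\ne0$, $0\le m_j<q-1$, $0\le k_0^{(j)},\dots,k_{g-1}^{(j)}\le p-1$, and the tuples $(m_j,k_0^{(j)},\dots,k_{g-1}^{(j)})$ are pairwise distinct. (The elements $e^m\prod_iM_{k_i}^{[i]}$ with $0\le m<q-1$, $0\le k_i\le p-1$ are exactly the classes of the pairwise non-isomorphic irreducible $\mathbb{F}_q$-representations of $G$.) *)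

theory Defs
  imports
    Jordan_Normal_Form.Determinant
    "HOL-Library.Poly_Mapping"
    "HOL-Library.Cardinality"
    "HOL-Computational_Algebra.Primes"
    "HOL-Computational_Algebra.Polynomial"
begin

section \<open>Representations of the group of invertible two by two matrices\<close>

definition GL2 :: "'a::field mat set"
  where "GL2 = {A \<in> carrier_mat 2 2. invertible_mat A}"

lemma GL2_carrier: "A \<in> GL2 \<Longrightarrow> A \<in> carrier_mat 2 2"
  by (simp add: GL2_def)

lemma invertible_mat_iff:
  assumes "A \<in> carrier_mat n n"
  shows "invertible_mat A \<longleftrightarrow> (\<exists>B\<in>carrier_mat n n. A * B = 1\<^sub>m n \<and> B * A = 1\<^sub>m n)"
proof
  assume "invertible_mat A"
  then obtain B where B: "A * B = 1\<^sub>m n" "B * A = 1\<^sub>m (dim_row B)"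
    using assms by (auto simp: invertible_mat_def inverts_mat_def)
  have "dim_col B = n" using arg_cong[OF B(1), of dim_col] by simp
  moreover have "dim_row B = n" using arg_cong[OF B(2), of dim_col] assms by simp
  ultimately show "\<exists>B\<in>carrier_mat n n. A * B = 1\<^sub>m n \<and> B * A = 1\<^sub>m n"
    using B by auto
qed (use assms in \<open>auto simp: invertible_mat_def inverts_mat_def\<close>)

lemma one_GL2 [simp]: "1\<^sub>m 2 \<in> GL2"
  by (auto simp: GL2_def invertible_mat_iff[of _ 2] intro!: bexI[of _ "1\<^sub>m 2"])

text \<open>Up to isomorphism, a finitely generated module over the group algebra is a coordinate
  space with a matrix representation.  Values of the matrix representation outside \<^term>\<open>GL2\<close>
  are irrelevant.\<close>

definition is_rep :: "nat \<times> ('a::field mat \<Rightarrow> 'a mat) \<Rightarrow> bool"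
  where "is_rep = (\<lambda>(n, \<rho>).
      (\<forall>A\<in>GL2. \<rho> A \<in> carrier_mat n n) \<and> \<rho> (1\<^sub>m 2) = 1\<^sub>m n \<and>
      (\<forall>A\<in>GL2. \<forall>B\<in>GL2. \<rho> (A * B) = \<rho> A * \<rho> B))"

lemma is_rep_Pair: "is_rep (n, \<rho>) \<longleftrightarrow>
    (\<forall>A\<in>GL2. \<rho> A \<in> carrier_mat n n) \<and> \<rho> (1\<^sub>m 2) = 1\<^sub>m n \<and>
    (\<forall>A\<in>GL2. \<forall>B\<in>GL2. \<rho> (A * B) = \<rho> A * \<rho> B)"
  by (simp add: is_rep_def)

typedef (overloaded) 'a::field rep = "{r :: nat \<times> ('a mat \<Rightarrow> 'a mat). is_rep r}"
  by (rule exI[of _ "(0, \<lambda>_. 1\<^sub>m 0)"]) (auto simp: is_rep_Pair)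

setup_lifting type_definition_rep

text \<open>Matrices are to be kept as they are in the lifted definitions below.\<close>
lifting_forget mat.lifting

lift_definition rep_dim :: "'a::field rep \<Rightarrow> nat" is fst .

lift_definition rep_mat :: "'a::field rep \<Rightarrow> 'a mat \<Rightarrow> 'a mat" is snd .

lemma rep_mat_carrier: "A \<in> GL2 \<Longrightarrow> rep_mat r A \<in> carrier_mat (rep_dim r) (rep_dim r)"
  by transfer (auto simp: is_rep_def)

definition rep_short_exact :: "'a::field rep \<Rightarrow> 'a rep \<Rightarrow> 'a rep \<Rightarrow> bool"
  where "rep_short_exact r' r r'' \<longleftrightarrow>
    (\<exists>A \<in> carrier_mat (rep_dim r) (rep_dim r'). \<exists>B \<in> carrier_mat (rep_dim r'') (rep_dim r).
      (\<forall>X\<in>GL2. A * rep_mat r' X = rep_mat r X * A) \<and>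
      (\<forall>X\<in>GL2. B * rep_mat r X = rep_mat r'' X * B) \<and>
      inj_on (\<lambda>v. A *\<^sub>v v) (carrier_vec (rep_dim r')) \<and>
      (\<lambda>v. A *\<^sub>v v) ` carrier_vec (rep_dim r') =
        {v \<in> carrier_vec (rep_dim r). B *\<^sub>v v = 0\<^sub>v (rep_dim r'')} \<and>
      (\<lambda>v. B *\<^sub>v v) ` carrier_vec (rep_dim r) = carrier_vec (rep_dim r''))"

subsection \<open>Tensor products\<close>

definition kron :: "'a::semiring_0 mat \<Rightarrow> 'a mat \<Rightarrow> 'a mat"
  where "kron A B = mat (dim_row A * dim_row B) (dim_col A * dim_col B)
    (\<lambda>(i, j). A $$ (i div dim_row B, j div dim_col B) * B $$ (i mod dim_row B, j mod dim_col B))"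

lemma kron_carrier:
  "A \<in> carrier_mat a b \<Longrightarrow> B \<in> carrier_mat c d \<Longrightarrow> kron A B \<in> carrier_mat (a * c) (b * d)"
  by (auto simp: kron_def)

lemma div_mod_bound:
  fixes i a b :: nat
  assumes "i < a * b"
  shows "i div b < a" "i mod b < b" "0 < b" "0 < a"
proof -
  show "0 < b" "0 < a" using assms by (auto intro: gr0I)
  then show "i div b < a" "i mod b < b"
    using assms by (auto simp: less_mult_imp_div_less)
qed

lemma mult_add_bound:
  fixes x y a b :: nat
  assumes "x < a" "y < b"
  shows "x * b + y < a * b"
proof -
  have "x * b + y < Suc x * b" using assms(2) by simp
  also have "\<dots> \<le> a * b" using assms(1) by (intro mult_right_mono) auto
  finally show ?thesis .
qed

lemma sum_div_mod:
  "(\<Sum>k<(a::nat) * b. f (k div b) (k mod b)) = (\<Sum>x<a. \<Sum>y<b. f x y :: 'b::comm_monoid_add)"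
proof -
  have "(\<Sum>k<a * b. f (k div b) (k mod b)) = (\<Sum>(x, y)\<in>{..<a} \<times> {..<b}. f x y)"
    by (rule sum.reindex_bij_witness[of _ "\<lambda>(x, y). x * b + y" "\<lambda>k. (k div b, k mod b)"])
       (auto simp: div_mod_bound mult_add_bound)
  then show ?thesis by (simp add: sum.cartesian_product)
qed

lemma kron_mult:
  fixes A B C D :: "'a::comm_semiring_0 mat"
  assumes "A \<in> carrier_mat a b" "B \<in> carrier_mat b c" "C \<in> carrier_mat d e" "D \<in> carrier_mat e f"
  shows "kron (A * B) (C * D) = kron A C * kron B D"
proof (rule eq_matI)
  fix i j assume "i < dim_row (kron A C * kron B D)" "j < dim_col (kron A C * kron B D)"
  then have i: "i < a * d" and j: "j < c * f" using assms by (auto simp: kron_def)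
  note bnd = div_mod_bound[OF i] div_mod_bound[OF j]
  have "(kron A C * kron B D) $$ (i, j) = (\<Sum>k<b * e.
      (A $$ (i div d, k div e) * C $$ (i mod d, k mod e)) *
      (B $$ (k div e, j div f) * D $$ (k mod e, j mod f)))"
    using assms i j
    by (auto simp: kron_def scalar_prod_def lessThan_atLeast0 intro!: sum.cong)
  also have "\<dots> = (\<Sum>x<b. \<Sum>y<e. (A $$ (i div d, x) * C $$ (i mod d, y)) *
      (B $$ (x, j div f) * D $$ (y, j mod f)))"
    by (rule sum_div_mod)
  also have "\<dots> = (\<Sum>x<b. A $$ (i div d, x) * B $$ (x, j div f)) *
      (\<Sum>y<e. C $$ (i mod d, y) * D $$ (y, j mod f))"
    by (simp add: sum_product mult_ac)
  also have "\<dots> = kron (A * B) (C * D) $$ (i, j)"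
    using assms i j bnd by (auto simp: kron_def scalar_prod_def lessThan_atLeast0)
  finally show "kron (A * B) (C * D) $$ (i, j) = (kron A C * kron B D) $$ (i, j)" ..
qed (use assms in \<open>auto simp: kron_def\<close>)

lemma kron_one: "kron (1\<^sub>m a) (1\<^sub>m b) = (1\<^sub>m (a * b) :: 'a::semiring_1 mat)"
proof (rule eq_matI)
  fix i j assume "i < dim_row (1\<^sub>m (a * b) :: 'a mat)" "j < dim_col (1\<^sub>m (a * b) :: 'a mat)"
  then have ij: "i < a * b" "j < a * b" by auto
  have "i = j \<longleftrightarrow> i div b = j div b \<and> i mod b = j mod b"
    by (metis div_mult_mod_eq)
  then show "kron (1\<^sub>m a) (1\<^sub>m b) $$ (i, j) = (1\<^sub>m (a * b) :: 'a mat) $$ (i, j)"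
    using ij div_mod_bound[OF ij(1)] div_mod_bound[OF ij(2)] by (auto simp: kron_def)
qed (auto simp: kron_def)

lift_definition rep_tensor :: "'a::field rep \<Rightarrow> 'a rep \<Rightarrow> 'a rep" is
  "\<lambda>(n, \<rho>) (m, \<tau>). (n * m, \<lambda>A. kron (\<rho> A) (\<tau> A))"
proof -
  fix r s :: "nat \<times> ('a mat \<Rightarrow> 'a mat)"
  obtain n \<rho> m \<tau> where rs: "r = (n, \<rho>)" "s = (m, \<tau>)" by (cases r, cases s)
  show "is_rep r \<Longrightarrow> is_rep s \<Longrightarrow>
      is_rep ((case r of (n, \<rho>) \<Rightarrow> \<lambda>(m, \<tau>). (n * m, \<lambda>A. kron (\<rho> A) (\<tau> A))) s)"
    by (simp add: rs is_rep_Pair kron_carrier kron_one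
        kron_mult[where a = n and b = n and c = n and d = m and e = m and f = m])
qed

subsection \<open>Powers of the determinant, symmetric powers, Frobenius twists\<close>

lift_definition det_rep :: "int \<Rightarrow> 'a::field rep" is
  "\<lambda>m. (1, \<lambda>A. mat 1 1 (\<lambda>_. det A powi m))"
proof -
  fix m
  have "mat 1 1 (\<lambda>_. det (A * B) powi m) =
      mat 1 1 (\<lambda>_. det A powi m) * mat 1 1 (\<lambda>_. det B powi m)"
    if "A \<in> GL2" "B \<in> GL2" for A B :: "'a mat"
    using that
    by (intro eq_matI) (auto simp: GL2_def det_mult[of _ 2] power_int_mult_distrib scalar_prod_def)
  then show "is_rep (1, \<lambda>A::'a mat. mat 1 1 (\<lambda>_. det A powi m))"
    by (auto simp: is_rep_Pair)
qed

text \<open>The basis of the \<open>k\<close>-th symmetric power of the standard representation with basis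
  \<open>e\<^sub>0, e\<^sub>1\<close> consists of the monomials \<open>e\<^sub>0\<^bsup>k - j\<^esup> e\<^sub>1\<^bsup>j\<^esup>\<close> for \<open>j \<le> k\<close>.  A matrix \<open>A\<close> sends the
  \<open>j\<close>-th one to the product of powers \<open>(A e\<^sub>0)\<^bsup>k - j\<^esup> (A e\<^sub>1)\<^bsup>j\<^esup>\<close>, which is expanded by
  setting \<open>e\<^sub>0 = 1\<close> and reading \<open>e\<^sub>1\<close> as the indeterminate of a univariate polynomial.\<close>

definition sym_mat :: "nat \<Rightarrow> 'a::field mat \<Rightarrow> 'a mat"
  where "sym_mat k A = mat (k + 1) (k + 1) (\<lambda>(i, j).
    coeff ([:A $$ (0, 0), A $$ (1, 0):] ^ (k - j) * [:A $$ (0, 1), A $$ (1, 1):] ^ j) i)"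

text \<open>Homogenisation of a polynomial of degree at most \<open>k\<close>, evaluated at a pair of polynomials.\<close>

definition homog :: "nat \<Rightarrow> 'a::field poly \<Rightarrow> 'a poly \<Rightarrow> 'a poly \<Rightarrow> 'a poly"
  where "homog k u v f = (\<Sum>l\<le>k. smult (coeff f l) (u ^ (k - l) * v ^ l))"

lemma homog_linear:
  assumes "degree f \<le> k"
  shows "homog (Suc k) u v ([:a, b:] * f) = (smult a u + smult b v) * homog k u v f"
proof -
  have z: "coeff f (Suc k) = 0" using assms by (simp add: coeff_eq_0)
  have c: "coeff ([:a, b:] * f) l = a * coeff f l + b * (case l of 0 \<Rightarrow> 0 | Suc i \<Rightarrow> coeff f i)"
    for l
    by (simp add: coeff_pCons split: nat.split)
  have "homog (Suc k) u v ([:a, b:] * f)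
      = (\<Sum>l\<le>Suc k. smult (a * coeff f l) (u ^ (Suc k - l) * v ^ l)) +
        (\<Sum>l\<le>Suc k. smult (b * (case l of 0 \<Rightarrow> 0 | Suc i \<Rightarrow> coeff f i))
          (u ^ (Suc k - l) * v ^ l))"
    unfolding homog_def c by (simp only: smult_add_left sum.distrib)
  also have "(\<Sum>l\<le>Suc k. smult (a * coeff f l) (u ^ (Suc k - l) * v ^ l))
      = (\<Sum>l\<le>k. smult (a * coeff f l) (u ^ (Suc k - l) * v ^ l))"
    by (simp add: z)
  also have "\<dots> = smult a u * homog k u v f"
    unfolding homog_def sum_distrib_left by (rule sum.cong) (auto simp: Suc_diff_le mult_ac)
  also have "(\<Sum>l\<le>Suc k. smult (b * (case l of 0 \<Rightarrow> 0 | Suc i \<Rightarrow> coeff f i))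
      (u ^ (Suc k - l) * v ^ l)) = smult b v * homog k u v f"
    unfolding homog_def sum_distrib_left sum.atMost_Suc_shift
    by (auto simp: mult_ac intro!: sum.cong)
  finally show ?thesis by (simp add: algebra_simps)
qed

lemma homog_powers:
  "homog (m + n) u v ([:a, b:] ^ m * [:c, d:] ^ n) =
    (smult a u + smult b v) ^ m * (smult c u + smult d v) ^ n"
proof (induction m)
  case 0
  show ?case
  proof (induction n)
    case (Suc n)
    have "degree ([:c, d:] ^ n) \<le> n"
      using degree_power_le[of "[:c, d:]" n] by (auto split: if_splits)
    from homog_linear[OF this, of u v c d] Suc show ?case
      by (simp only: power_Suc power_0 mult_1_left add_0_left)
  qed (simp add: homog_def)
next
  case (Suc m)
  have "degree ([:a, b:] ^ m * [:c, d:] ^ n) \<le> degree [:a, b:] * m + degree [:c, d:] * n"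
    by (rule order_trans[OF degree_mult_le]) (intro add_mono degree_power_le)
  also have "\<dots> \<le> 1 * m + 1 * n"
    by (intro add_mono mult_right_mono) auto
  finally have "degree ([:a, b:] ^ m * [:c, d:] ^ n) \<le> m + n" by simp
  from homog_linear[OF this, of u v a b] Suc show ?case
    by (simp only: power_Suc mult.assoc add_Suc)
qed

lemma sym_mat_mult:
  assumes A: "A \<in> carrier_mat 2 2" and B: "B \<in> carrier_mat 2 2"
  shows "sym_mat k (A * B) = sym_mat k A * sym_mat k B"
proof (rule eq_matI)
  fix i j assume "i < dim_row (sym_mat k A * sym_mat k B)" "j < dim_col (sym_mat k A * sym_mat k B)"
  then have i: "i \<le> k" and j: "j \<le> k" by (auto simp: sym_mat_def)
  define u v where "u = [:A $$ (0, 0), A $$ (1, 0):]" and "v = [:A $$ (0, 1), A $$ (1, 1):]"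
  define P where "P = [:B $$ (0, 0), B $$ (1, 0):] ^ (k - j) * [:B $$ (0, 1), B $$ (1, 1):] ^ j"
  have entry: "(A * B) $$ (r, s) = A $$ (r, 0) * B $$ (0, s) + A $$ (r, 1) * B $$ (1, s)"
    if "r < 2" "s < 2" for r s
    using that A B by (auto simp: scalar_prod_def numeral_2_eq_2)
  have col: "[:(A * B) $$ (0, s), (A * B) $$ (1, s):] =
      smult (B $$ (0, s)) u + smult (B $$ (1, s)) v" if "s < 2" for s
    using that by (simp add: entry u_def v_def mult_ac)
  have two: "0 < (2::nat)" "1 < (2::nat)" by simp_all
  note cols = col[OF two(1)] col[OF two(2)]
  have "(sym_mat k A * sym_mat k B) $$ (i, j)
      = (\<Sum>l\<le>k. coeff (u ^ (k - l) * v ^ l) i * coeff P l)"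
    using i j by (simp add: sym_mat_def scalar_prod_def u_def v_def P_def
        atMost_atLeast0 atLeastLessThanSuc_atLeastAtMost)
  also have "\<dots> = coeff (homog k u v P) i"
    by (simp add: homog_def coeff_sum mult_ac)
  also have "homog k u v P = [:(A * B) $$ (0, 0), (A * B) $$ (1, 0):] ^ (k - j) *
      [:(A * B) $$ (0, 1), (A * B) $$ (1, 1):] ^ j"
    unfolding P_def cols
      homog_powers[of "k - j" j u v, unfolded le_add_diff_inverse2[OF j]] ..
  also have "coeff \<dots> i = sym_mat k (A * B) $$ (i, j)"
    using i j by (simp add: sym_mat_def)
  finally show "sym_mat k (A * B) $$ (i, j) = (sym_mat k A * sym_mat k B) $$ (i, j)" ..
qed (auto simp: sym_mat_def)

lemma sym_mat_one: "sym_mat k (1\<^sub>m 2) = (1\<^sub>m (k + 1) :: 'a::field mat)"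
proof -
  have "[:0, 1 :: 'a:] ^ j = monom 1 j" for j
    by (simp add: monom_altdef)
  then show ?thesis
    by (intro eq_matI) (auto simp: sym_mat_def simp flip: one_pCons)
qed

lift_definition sym_rep :: "nat \<Rightarrow> 'a::field rep" is "\<lambda>k. (k + 1, sym_mat k)"
  by (auto simp: is_rep_Pair sym_mat_one sym_mat_mult[OF GL2_carrier GL2_carrier])
     (auto simp: sym_mat_def)

definition frob :: "int \<Rightarrow> 'a::finite_field \<Rightarrow> 'a"
  where "frob n = (if 0 \<le> n then (\<lambda>x. x ^ CHAR('a) ^ nat n)
    else inv_into UNIV (\<lambda>x. x ^ CHAR('a) ^ nat (- n)))"

lemma frob_power_bij: "bij (\<lambda>x::'a::finite_field. x ^ CHAR('a) ^ n)"
proof -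
  have "inj (\<lambda>x::'a. x ^ CHAR('a) ^ n)"
  proof (rule injI)
    fix x y :: 'a assume eq: "x ^ CHAR('a) ^ n = y ^ CHAR('a) ^ n"
    have "(x - y + y) ^ CHAR('a) ^ n = (x - y) ^ CHAR('a) ^ n + y ^ CHAR('a) ^ n"
      by (rule freshmans_dream') auto
    with eq show "x = y" by simp
  qed
  then show ?thesis
    by (simp add: bij_def finite_UNIV_inj_surj)
qed

lemma inv_ring_hom:
  fixes h :: "'a::comm_ring_1 \<Rightarrow> 'a"
  assumes "comm_ring_hom h" "bij h"
  shows "comm_ring_hom (inv_into UNIV h)"
proof -
  interpret comm_ring_hom h by fact
  have [simp]: "h (inv_into UNIV h x) = x" "inv_into UNIV h (h x) = x" for x
    using assms(2) by (auto simp: bij_def surj_f_inv_f)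
  have inj: "x = y" if "h x = h y" for x y
    using that assms(2) by (metis bij_def injD)
  show ?thesis
    by unfold_locales (rule inj, simp add: hom_add hom_mult)+
qed

lemma frob_hom: "comm_ring_hom (frob n :: 'a::finite_field \<Rightarrow> 'a)"
proof -
  have *: "comm_ring_hom (\<lambda>x::'a. x ^ CHAR('a) ^ m)" for m
    by unfold_locales (auto simp: power_mult_distrib freshmans_dream')
  show ?thesis
  proof (cases "0 \<le> n")
    case True
    then show ?thesis using *[of "nat n"] by (simp only: frob_def if_True)
  next
    case False
    then show ?thesis
      using inv_ring_hom[OF *[of "nat (- n)"] frob_power_bij] by (simp only: frob_def if_False)
  qed
qed

lemma frob_GL2:
  fixes A :: "'a::finite_field mat"
  assumes "A \<in> GL2"
  shows "map_mat (frob n) A \<in> GL2"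
proof -
  interpret comm_ring_hom "frob n :: 'a \<Rightarrow> 'a" by (rule frob_hom)
  from assms obtain B where A: "A \<in> carrier_mat 2 2" and B: "B \<in> carrier_mat 2 2"
    and AB: "A * B = 1\<^sub>m 2" "B * A = 1\<^sub>m 2"
    by (auto simp: GL2_def invertible_mat_iff[of _ 2])
  have "mat_hom A * mat_hom B = 1\<^sub>m 2" "mat_hom B * mat_hom A = 1\<^sub>m 2"
    by (simp_all only: mat_hom_mult[OF A B, symmetric] mat_hom_mult[OF B A, symmetric] AB mat_hom_one)
  moreover have "mat_hom A \<in> carrier_mat 2 2" "mat_hom B \<in> carrier_mat 2 2"
    using A B by auto
  ultimately show ?thesis
    unfolding GL2_def using invertible_mat_iff[of "mat_hom A" 2] by blast
qed

lift_definition rep_twist :: "int \<Rightarrow> 'a::finite_field rep \<Rightarrow> 'a rep" is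
  "\<lambda>n (d, \<rho>). (d, \<lambda>A. \<rho> (map_mat (frob n) A))"
proof -
  fix n and r :: "nat \<times> ('a mat \<Rightarrow> 'a mat)"
  interpret comm_ring_hom "frob n :: 'a \<Rightarrow> 'a" by (rule frob_hom)
  show "is_rep r \<Longrightarrow> is_rep (case r of (d, \<rho>) \<Rightarrow> (d, \<lambda>A. \<rho> (map_mat (frob n) A)))"
    by (cases r) (auto simp: is_rep_Pair frob_GL2 mat_hom_one mat_hom_mult[OF GL2_carrier GL2_carrier])
qed

lift_definition triv_rep :: "'a::field rep" is "(1, \<lambda>_. 1\<^sub>m 1)"
  by (simp add: is_rep_Pair)

lift_definition zero_rep :: "'a::field rep" is "(0, \<lambda>_. 1\<^sub>m 0)"
  by (simp add: is_rep_Pair)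


section \<open>The Grothendieck ring\<close>

subsection \<open>Short exact sequences split as sequences of vector spaces\<close>

lemma mult_unit_vec:
  assumes "A \<in> carrier_mat m n" "j < n"
  shows "(A :: 'a::field mat) *\<^sub>v unit_vec n j = col A j"
  using assms by (intro eq_vecI) auto

lemma zero_mat_mult_vec:
  "v \<in> carrier_vec n \<Longrightarrow> (0\<^sub>m m n :: 'a::field mat) *\<^sub>v v = 0\<^sub>v m"
  by (intro eq_vecI) auto

lemma mat_eq_vecI:
  assumes "A \<in> carrier_mat m n" "B \<in> carrier_mat m n"
    and "\<And>v. v \<in> carrier_vec n \<Longrightarrow> (A :: 'a::field mat) *\<^sub>v v = B *\<^sub>v v"
  shows "A = B"
proof (rule mat_col_eqI)
  fix j assume "j < dim_col B"
  then show "col A j = col B j"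
    using assms(1,2) assms(3)[of "unit_vec n j"] mult_unit_vec[of A m n j] mult_unit_vec[of B m n j]
    by simp
qed (use assms in auto)

lemma choose_cols:
  assumes B: "B \<in> carrier_mat m n" and C: "C \<in> carrier_mat m k"
    and ex: "\<And>v. v \<in> carrier_vec k \<Longrightarrow> \<exists>w\<in>carrier_vec n. (B :: 'a::field mat) *\<^sub>v w = C *\<^sub>v v"
  obtains R where "R \<in> carrier_mat n k" "B * R = C"
proof -
  have "\<forall>j. \<exists>w\<in>carrier_vec n. B *\<^sub>v w = C *\<^sub>v unit_vec k j"
    using ex by simp
  then obtain w where w: "\<And>j. w j \<in> carrier_vec n" "\<And>j. B *\<^sub>v w j = C *\<^sub>v unit_vec k j"
    by metis
  define R where "R = mat n k (\<lambda>(i, j). w j $ i)"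
  have R: "R \<in> carrier_mat n k" by (simp add: R_def)
  have "B * R = C"
  proof (rule mat_col_eqI)
    fix j assume "j < dim_col C"
    then have j: "j < k" using C by simp
    have "col R j = w j" using j w(1)[of j] by (intro eq_vecI) (auto simp: R_def)
    then show "col (B * R) j = col C j"
      using col_mult2[OF B R j] w(2)[of j] mult_unit_vec[OF C j] by simp
  qed (use B C R in auto)
  with R that show ?thesis by blast
qed

definition split_exact :: "'a::field mat \<Rightarrow> 'a mat \<Rightarrow> 'a mat \<Rightarrow> 'a mat \<Rightarrow> nat \<Rightarrow> nat \<Rightarrow> nat \<Rightarrow> bool"
  where "split_exact A B L R n' n n'' \<longleftrightarrow>
    A \<in> carrier_mat n n' \<and> B \<in> carrier_mat n'' n \<and> L \<in> carrier_mat n' n \<and> R \<in> carrier_mat n n'' \<and>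
    L * A = 1\<^sub>m n' \<and> B * R = 1\<^sub>m n'' \<and> B * A = 0\<^sub>m n'' n' \<and> A * L + R * B = 1\<^sub>m n"

lemma short_exact_iff_split:
  fixes A B :: "'a::field mat"
  assumes A: "A \<in> carrier_mat n n'" and B: "B \<in> carrier_mat n'' n"
  shows "(inj_on (\<lambda>v. A *\<^sub>v v) (carrier_vec n') \<and>
      (\<lambda>v. A *\<^sub>v v) ` carrier_vec n' = {v \<in> carrier_vec n. B *\<^sub>v v = 0\<^sub>v n''} \<and>
      (\<lambda>v. B *\<^sub>v v) ` carrier_vec n = carrier_vec n'') \<longleftrightarrow>
    (\<exists>L R. split_exact A B L R n' n n'')"
proof (intro iffI; (elim conjE exE)?)
  assume inj: "inj_on (\<lambda>v. A *\<^sub>v v) (carrier_vec n')"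
    and ker: "(\<lambda>v. A *\<^sub>v v) ` carrier_vec n' = {v \<in> carrier_vec n. B *\<^sub>v v = 0\<^sub>v n''}"
    and surj: "(\<lambda>v. B *\<^sub>v v) ` carrier_vec n = carrier_vec n''"
  have BA: "B * A = 0\<^sub>m n'' n'"
  proof (rule mat_eq_vecI)
    fix v :: "'a vec" assume v: "v \<in> carrier_vec n'"
    then have "B *\<^sub>v (A *\<^sub>v v) = 0\<^sub>v n''" using ker by blast
    then show "B * A *\<^sub>v v = 0\<^sub>m n'' n' *\<^sub>v v"
      using assoc_mult_mat_vec[OF B A v] zero_mat_mult_vec[OF v] by simp
  qed (use A B in auto)
  obtain R where R: "R \<in> carrier_mat n n''" "B * R = 1\<^sub>m n''"
  proof (rule choose_cols[OF B, of "1\<^sub>m n''" n''])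
    fix v :: "'a vec" assume v: "v \<in> carrier_vec n''"
    then have "v \<in> (\<lambda>v. B *\<^sub>v v) ` carrier_vec n" using surj by simp
    then show "\<exists>w\<in>carrier_vec n. B *\<^sub>v w = 1\<^sub>m n'' *\<^sub>v v" using v by auto
  qed auto
  have RB: "R * B \<in> carrier_mat n n" using R B by auto
  define E where "E = 1\<^sub>m n - R * B"
  have E: "E \<in> carrier_mat n n" using RB by (simp add: E_def minus_carrier_mat)
  have "B * E = B - B * (R * B)"
    unfolding E_def using mult_minus_distrib_mat[OF B one_carrier_mat RB] B by simp
  also have "B * (R * B) = B"
    using assoc_mult_mat[OF B R(1) B] R(2) B by simp
  finally have BE: "B * E = 0\<^sub>m n'' n" using B by simp
  obtain L where L: "L \<in> carrier_mat n' n" "A * L = E"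
  proof (rule choose_cols[OF A E])
    fix v :: "'a vec" assume v: "v \<in> carrier_vec n"
    have "B *\<^sub>v (E *\<^sub>v v) = 0\<^sub>v n''"
      using assoc_mult_mat_vec[OF B E v] BE zero_mat_mult_vec[OF v] by simp
    then have "E *\<^sub>v v \<in> (\<lambda>v. A *\<^sub>v v) ` carrier_vec n'"
      unfolding ker using E v by simp
    then show "\<exists>w\<in>carrier_vec n'. A *\<^sub>v w = E *\<^sub>v v" by auto
  qed
  have sum: "A * L + R * B = 1\<^sub>m n"
    unfolding L(2) E_def using R(1) B by (intro eq_matI) auto
  have LA: "L * A \<in> carrier_mat n' n'" using L A by auto
  have "A * (L * A) = E * A" using assoc_mult_mat[OF A L(1) A] L(2) by simp
  also have "\<dots> = A - R * (B * A)"
    unfolding E_def using minus_mult_distrib_mat[OF one_carrier_mat RB A] assoc_mult_mat[OF R(1) B A] A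
    by simp
  also have "\<dots> = A" using A R(1) BA by (intro eq_matI) auto
  finally have ALA: "A * (L * A) = A" .
  have "L * A = 1\<^sub>m n'"
  proof (rule mat_eq_vecI[OF LA one_carrier_mat])
    fix v :: "'a vec" assume v: "v \<in> carrier_vec n'"
    have "A *\<^sub>v (L * A *\<^sub>v v) = A *\<^sub>v v"
      using assoc_mult_mat_vec[OF A LA v] ALA by simp
    then have "L * A *\<^sub>v v = v"
      using inj_onD[OF inj, of "L * A *\<^sub>v v" v] LA v by simp
    then show "L * A *\<^sub>v v = 1\<^sub>m n' *\<^sub>v v" using v by simp
  qed
  then have "split_exact A B L R n' n n''"
    unfolding split_exact_def by (intro conjI A B L(1) R BA sum)
  then show "\<exists>L R. split_exact A B L R n' n n''" by blast
next
  fix L R assume "split_exact A B L R n' n n''"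
  then have L: "L \<in> carrier_mat n' n" and R: "R \<in> carrier_mat n n''"
    and LA: "L * A = 1\<^sub>m n'" and BR: "B * R = 1\<^sub>m n''" and BA: "B * A = 0\<^sub>m n'' n'"
    and sum: "A * L + R * B = 1\<^sub>m n"
    by (auto simp: split_exact_def)
  have LAv: "L *\<^sub>v (A *\<^sub>v v) = v" if "v \<in> carrier_vec n'" for v
    using assoc_mult_mat_vec[OF L A that] LA that by simp
  have BAv: "B *\<^sub>v (A *\<^sub>v v) = 0\<^sub>v n''" if "v \<in> carrier_vec n'" for v
    using assoc_mult_mat_vec[OF B A that] BA zero_mat_mult_vec[OF that] by simp
  have BRv: "B *\<^sub>v (R *\<^sub>v v) = v" if "v \<in> carrier_vec n''" for v
    using assoc_mult_mat_vec[OF B R that] BR that by simp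
  have dec: "A *\<^sub>v (L *\<^sub>v v) + R *\<^sub>v (B *\<^sub>v v) = v" if "v \<in> carrier_vec n" for v
    using assoc_mult_mat_vec[OF A L that] assoc_mult_mat_vec[OF R B that] sum that
      add_mult_distrib_mat_vec[OF mult_carrier_mat[OF A L] mult_carrier_mat[OF R B] that]
    by simp
  have "v \<in> (\<lambda>v. A *\<^sub>v v) ` carrier_vec n'" if v: "v \<in> carrier_vec n" "B *\<^sub>v v = 0\<^sub>v n''" for v
  proof (rule image_eqI)
    have "R *\<^sub>v 0\<^sub>v n'' = 0\<^sub>v n" using R by (intro eq_vecI) auto
    then show "v = A *\<^sub>v (L *\<^sub>v v)"
      using dec[OF v(1)] v(2) mult_mat_vec_carrier[OF A mult_mat_vec_carrier[OF L v(1)]] by simp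
  qed (use L v in simp)
  then have "(\<lambda>v. A *\<^sub>v v) ` carrier_vec n' = {v \<in> carrier_vec n. B *\<^sub>v v = 0\<^sub>v n''}"
    using A BAv by auto
  moreover have "inj_on (\<lambda>v. A *\<^sub>v v) (carrier_vec n')"
    by (rule inj_on_inverseI[where g = "\<lambda>v. L *\<^sub>v v"]) (rule LAv)
  moreover have "(\<lambda>v. B *\<^sub>v v) ` carrier_vec n = carrier_vec n''"
  proof
    show "carrier_vec n'' \<subseteq> (\<lambda>v. B *\<^sub>v v) ` carrier_vec n"
    proof
      fix v :: "'a vec" assume v: "v \<in> carrier_vec n''"
      show "v \<in> (\<lambda>v. B *\<^sub>v v) ` carrier_vec n"
        using BRv[OF v, symmetric] mult_mat_vec_carrier[OF R v]
        by (rule image_eqI[where f = "\<lambda>v. B *\<^sub>v v"])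
    qed
  qed (use B in auto)
  ultimately show "inj_on (\<lambda>v. A *\<^sub>v v) (carrier_vec n') \<and>
      (\<lambda>v. A *\<^sub>v v) ` carrier_vec n' = {v \<in> carrier_vec n. B *\<^sub>v v = 0\<^sub>v n''} \<and>
      (\<lambda>v. B *\<^sub>v v) ` carrier_vec n = carrier_vec n''"
    by (intro conjI)
qed

lemma rep_short_exact_iff:
  "rep_short_exact r' r r'' \<longleftrightarrow>
    (\<exists>A B L R. split_exact A B L R (rep_dim r') (rep_dim r) (rep_dim r'') \<and>
      (\<forall>X\<in>GL2. A * rep_mat r' X = rep_mat r X * A) \<and>
      (\<forall>X\<in>GL2. B * rep_mat r X = rep_mat r'' X * B))"
  (is "_ \<longleftrightarrow> ?rhs")
proof
  assume "rep_short_exact r' r r''"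
  then obtain A B where A: "A \<in> carrier_mat (rep_dim r) (rep_dim r')"
    and B: "B \<in> carrier_mat (rep_dim r'') (rep_dim r)"
    and eq: "\<forall>X\<in>GL2. A * rep_mat r' X = rep_mat r X * A"
      "\<forall>X\<in>GL2. B * rep_mat r X = rep_mat r'' X * B"
    and "\<exists>L R. split_exact A B L R (rep_dim r') (rep_dim r) (rep_dim r'')"
    unfolding rep_short_exact_def
    by (elim bexE conjE) (simp add: short_exact_iff_split[symmetric])
  then show ?rhs by blast
next
  assume ?rhs
  then obtain A B L R where eq: "\<forall>X\<in>GL2. A * rep_mat r' X = rep_mat r X * A"
      "\<forall>X\<in>GL2. B * rep_mat r X = rep_mat r'' X * B"
    and s: "split_exact A B L R (rep_dim r') (rep_dim r) (rep_dim r'')"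
    by blast
  from s have A: "A \<in> carrier_mat (rep_dim r) (rep_dim r')"
    and B: "B \<in> carrier_mat (rep_dim r'') (rep_dim r)"
    by (simp_all add: split_exact_def)
  have "\<exists>L R. split_exact A B L R (rep_dim r') (rep_dim r) (rep_dim r'')"
    using s by (intro exI)
  from this[folded short_exact_iff_split[OF A B]] show "rep_short_exact r' r r''"
    unfolding rep_short_exact_def by (intro bexI[OF _ A] bexI[OF _ B] conjI eq) simp_all
qed


lemma rep_short_exact_twist:
  assumes "rep_short_exact r' r r''"
  shows "rep_short_exact (rep_twist n r') (rep_twist n r) (rep_twist n r'')"
proof -
  have "rep_dim (rep_twist n r) = rep_dim r"
    "rep_mat (rep_twist n r) X = rep_mat r (map_mat (frob n) X)" for r :: "'a rep" and X
    by (transfer; auto)+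
  with assms frob_GL2[where n = n] show ?thesis
    unfolding rep_short_exact_iff by metis
qed

lemma rep_dim_tensor [simp]: "rep_dim (rep_tensor r s) = rep_dim r * rep_dim s"
  by transfer auto

lemma rep_mat_tensor [simp]: "rep_mat (rep_tensor r s) X = kron (rep_mat r X) (rep_mat s X)"
  by transfer auto

lemma kron_add_left:
  fixes A B C :: "'a::comm_ring_1 mat"
  assumes "A \<in> carrier_mat m n" "B \<in> carrier_mat m n"
  shows "kron (A + B) C = kron A C + kron B C"
  using assms by (intro eq_matI) (auto simp: kron_def distrib_right div_mod_bound)

lemma kron_add_right:
  fixes A B C :: "'a::comm_ring_1 mat"
  assumes "A \<in> carrier_mat m n" "B \<in> carrier_mat m n"
  shows "kron C (A + B) = kron C A + kron C B"
  using assms by (intro eq_matI) (auto simp: kron_def distrib_left div_mod_bound)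

lemma kron_zero:
  fixes C :: "'a::comm_ring_1 mat"
  assumes "C \<in> carrier_mat c d"
  shows "kron (0\<^sub>m m n) C = 0\<^sub>m (m * c) (n * d)" "kron C (0\<^sub>m m n) = 0\<^sub>m (c * m) (d * n)"
  using assms by (auto simp: kron_def div_mod_bound intro!: eq_matI)

lemma rep_short_exact_tensor:
  fixes r r' r'' s :: "'a::field rep"
  assumes "rep_short_exact r' r r''"
  shows "rep_short_exact (rep_tensor r' s) (rep_tensor r s) (rep_tensor r'' s)"
    and "rep_short_exact (rep_tensor s r') (rep_tensor s r) (rep_tensor s r'')"
proof -
  define n n' n'' m where "n = rep_dim r" and "n' = rep_dim r'" and "n'' = rep_dim r''"
    and "m = rep_dim s"
  obtain A B L R where "split_exact A B L R n' n n''"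
    and A_eq: "\<And>X. X \<in> GL2 \<Longrightarrow> A * rep_mat r' X = rep_mat r X * A"
    and B_eq: "\<And>X. X \<in> GL2 \<Longrightarrow> B * rep_mat r X = rep_mat r'' X * B"
    using assms unfolding rep_short_exact_iff n_def n'_def n''_def by blast
  then have A: "A \<in> carrier_mat n n'" and B: "B \<in> carrier_mat n'' n"
    and L: "L \<in> carrier_mat n' n" and R: "R \<in> carrier_mat n n''"
    and LA: "L * A = 1\<^sub>m n'" and BR: "B * R = 1\<^sub>m n''" and BA: "B * A = 0\<^sub>m n'' n'"
    and sum: "A * L + R * B = 1\<^sub>m n"
    by (simp_all add: split_exact_def)
  have I: "(1\<^sub>m m :: 'a mat) \<in> carrier_mat m m" by simp
  note AL = mult_carrier_mat[OF A L] and RB = mult_carrier_mat[OF R B]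
  have II: "(1\<^sub>m m :: 'a mat) * 1\<^sub>m m = 1\<^sub>m m" by simp
  have "split_exact (kron A (1\<^sub>m m)) (kron B (1\<^sub>m m)) (kron L (1\<^sub>m m)) (kron R (1\<^sub>m m))
      (n' * m) (n * m) (n'' * m)"
    unfolding split_exact_def
    by (simp only: kron_mult[OF L A I I, symmetric] kron_mult[OF B R I I, symmetric]
        kron_mult[OF B A I I, symmetric] kron_mult[OF A L I I, symmetric]
        kron_mult[OF R B I I, symmetric] kron_carrier[OF A I] kron_carrier[OF B I]
        kron_carrier[OF L I] kron_carrier[OF R I] II LA BR BA kron_one kron_zero[OF I]
        kron_add_left[OF AL RB, symmetric] sum simp_thms)
  moreover have "kron A (1\<^sub>m m) * kron (rep_mat r' X) (rep_mat s X) =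
      kron (rep_mat r X) (rep_mat s X) * kron A (1\<^sub>m m)"
    "kron B (1\<^sub>m m) * kron (rep_mat r X) (rep_mat s X) =
      kron (rep_mat r'' X) (rep_mat s X) * kron B (1\<^sub>m m)" if X: "X \<in> GL2" for X
  proof -
    note r' = rep_mat_carrier[OF X, of r', folded n'_def]
      and r = rep_mat_carrier[OF X, of r, folded n_def]
      and r'' = rep_mat_carrier[OF X, of r'', folded n''_def]
      and s = rep_mat_carrier[OF X, of s, folded m_def]
    show "kron A (1\<^sub>m m) * kron (rep_mat r' X) (rep_mat s X) =
        kron (rep_mat r X) (rep_mat s X) * kron A (1\<^sub>m m)"
      unfolding kron_mult[OF A r' I s, symmetric] kron_mult[OF r A s I, symmetric]
        A_eq[OF X] left_mult_one_mat[OF s] right_mult_one_mat[OF s] ..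
    show "kron B (1\<^sub>m m) * kron (rep_mat r X) (rep_mat s X) =
        kron (rep_mat r'' X) (rep_mat s X) * kron B (1\<^sub>m m)"
      unfolding kron_mult[OF B r I s, symmetric] kron_mult[OF r'' B s I, symmetric]
        B_eq[OF X] left_mult_one_mat[OF s] right_mult_one_mat[OF s] ..
  qed
  ultimately show "rep_short_exact (rep_tensor r' s) (rep_tensor r s) (rep_tensor r'' s)"
    unfolding rep_short_exact_iff rep_dim_tensor rep_mat_tensor n_def n'_def n''_def m_def
    by blast
  have "split_exact (kron (1\<^sub>m m) A) (kron (1\<^sub>m m) B) (kron (1\<^sub>m m) L) (kron (1\<^sub>m m) R)
      (m * n') (m * n) (m * n'')"
    unfolding split_exact_def
    by (simp only: kron_mult[OF I I L A, symmetric] kron_mult[OF I I B R, symmetric]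
        kron_mult[OF I I B A, symmetric] kron_mult[OF I I A L, symmetric]
        kron_mult[OF I I R B, symmetric] kron_carrier[OF I A] kron_carrier[OF I B]
        kron_carrier[OF I L] kron_carrier[OF I R] II LA BR BA kron_one kron_zero[OF I]
        kron_add_right[OF AL RB, symmetric] sum simp_thms)
  moreover have "kron (1\<^sub>m m) A * kron (rep_mat s X) (rep_mat r' X) =
      kron (rep_mat s X) (rep_mat r X) * kron (1\<^sub>m m) A"
    "kron (1\<^sub>m m) B * kron (rep_mat s X) (rep_mat r X) =
      kron (rep_mat s X) (rep_mat r'' X) * kron (1\<^sub>m m) B" if X: "X \<in> GL2" for X
  proof -
    note r' = rep_mat_carrier[OF X, of r', folded n'_def]
      and r = rep_mat_carrier[OF X, of r, folded n_def]
      and r'' = rep_mat_carrier[OF X, of r'', folded n''_def]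
      and s = rep_mat_carrier[OF X, of s, folded m_def]
    show "kron (1\<^sub>m m) A * kron (rep_mat s X) (rep_mat r' X) =
        kron (rep_mat s X) (rep_mat r X) * kron (1\<^sub>m m) A"
      unfolding kron_mult[OF I s A r', symmetric] kron_mult[OF s I r A, symmetric]
        A_eq[OF X] left_mult_one_mat[OF s] right_mult_one_mat[OF s] ..
    show "kron (1\<^sub>m m) B * kron (rep_mat s X) (rep_mat r X) =
        kron (rep_mat s X) (rep_mat r'' X) * kron (1\<^sub>m m) B"
      unfolding kron_mult[OF I s B r, symmetric] kron_mult[OF s I r'' B, symmetric]
        B_eq[OF X] left_mult_one_mat[OF s] right_mult_one_mat[OF s] ..
  qed
  ultimately show "rep_short_exact (rep_tensor s r') (rep_tensor s r) (rep_tensor s r'')"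
    unfolding rep_short_exact_iff rep_dim_tensor rep_mat_tensor n_def n'_def n''_def m_def
    by blast
qed

subsection \<open>The group\<close>

text \<open>The subgroup of the free abelian group on all representations that is generated by
  the relations coming from short exact sequences.\<close>

inductive_set exact_relations :: "('a::field rep \<Rightarrow>\<^sub>0 int) set" where
  exact: "rep_short_exact r' r r'' \<Longrightarrow> frag_of r - frag_of r' - frag_of r'' \<in> exact_relations"
| zero: "0 \<in> exact_relations"
| diff: "x \<in> exact_relations \<Longrightarrow> y \<in> exact_relations \<Longrightarrow> x - y \<in> exact_relations"

lemma exact_relations_uminus: "x \<in> exact_relations \<Longrightarrow> - x \<in> exact_relations"
  using exact_relations.diff[OF exact_relations.zero] by fastforce

lemma exact_relations_add:
  "x \<in> exact_relations \<Longrightarrow> y \<in> exact_relations \<Longrightarrow> x + y \<in> exact_relations"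
  using exact_relations.diff[OF _ exact_relations_uminus] by fastforce

quotient_type (overloaded) 'a K0 = "'a::finite_field rep \<Rightarrow>\<^sub>0 int" /
  "\<lambda>x y. x - y \<in> exact_relations"
proof (intro equivpI reflpI sympI transpI)
  fix x y z :: "'a rep \<Rightarrow>\<^sub>0 int"
  show "x - x \<in> exact_relations" by (simp add: exact_relations.zero)
  show "y - x \<in> exact_relations" if "x - y \<in> exact_relations"
    using exact_relations_uminus[OF that] by simp
  show "x - z \<in> exact_relations" if "x - y \<in> exact_relations" "y - z \<in> exact_relations"
    using exact_relations_add[OF that] by simp
qed

lifting_forget rep.lifting
lifting_forget poly_mapping.lifting

lift_definition K0_class :: "'a::finite_field rep \<Rightarrow> 'a K0" is frag_of .

subsection \<open>The ring structure\<close>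

definition free_tensor ::
  "('a::field rep \<Rightarrow>\<^sub>0 int) \<Rightarrow> ('a rep \<Rightarrow>\<^sub>0 int) \<Rightarrow> 'a rep \<Rightarrow>\<^sub>0 int"
  where "free_tensor x y = frag_extend (\<lambda>r. frag_extend (\<lambda>s. frag_of (rep_tensor r s)) y) x"

lemma free_tensor_of [simp]: "free_tensor (frag_of r) (frag_of s) = frag_of (rep_tensor r s)"
  by (simp add: free_tensor_def)

lemma free_tensor_zero [simp]: "free_tensor 0 y = 0" "free_tensor x 0 = 0"
  by (simp_all add: free_tensor_def frag_extend_eq_0)

lemma free_tensor_diff_left: "free_tensor (x - x') y = free_tensor x y - free_tensor x' y"
  by (simp add: free_tensor_def frag_extend_diff)

lemma free_induct [case_names zero one diff]:
  assumes "P 0" "\<And>r. P (frag_of r)" "\<And>x y. P x \<Longrightarrow> P y \<Longrightarrow> P (x - y)"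
  shows "P x"
  by (rule frag_induction[of x UNIV]) (use assms in auto)

lemma free_tensor_diff_right: "free_tensor x (y - y') = free_tensor x y - free_tensor x y'"
  by (induction x rule: free_induct)
     (simp_all add: free_tensor_diff_left, simp add: free_tensor_def frag_extend_diff)

lemma diff_diff_eq_swap: "(a - c) - (b - d) = (a - b) - (c - d)"
  for a :: "'a::ab_group_add"
  by (simp add: algebra_simps)

lemma free_tensor_exact_left:
  assumes "x \<in> exact_relations"
  shows "free_tensor x y \<in> exact_relations"
  using assms
proof induction
  case (exact r' r r'')
  show ?case
  proof (induction y rule: free_induct)
    case (one s)
    show ?case
      by (simp add: free_tensor_diff_left exact_relations.exact rep_short_exact_tensor(1)[OF exact])
  next
    case (diff y z)
    then show ?case by (simp only: free_tensor_diff_right exact_relations.diff)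
  qed (simp add: exact_relations.zero)
qed (simp_all add: free_tensor_diff_left exact_relations.intros)

lemma free_tensor_exact_right:
  assumes "y \<in> exact_relations"
  shows "free_tensor x y \<in> exact_relations"
  using assms
proof induction
  case (exact r' r r'')
  show ?case
  proof (induction x rule: free_induct)
    case (one s)
    show ?case
      by (simp add: free_tensor_diff_right exact_relations.exact rep_short_exact_tensor(2)[OF exact])
  next
    case (diff x z)
    then show ?case by (simp only: free_tensor_diff_left exact_relations.diff)
  qed (simp add: exact_relations.zero)
qed (simp_all add: free_tensor_diff_right exact_relations.intros)

lemma exact_relations_iso:
  fixes r s :: "'a::field rep"
  assumes P: "P \<in> carrier_mat (rep_dim s) (rep_dim r)" and Q: "Q \<in> carrier_mat (rep_dim r) (rep_dim s)"
    and PQ: "P * Q = 1\<^sub>m (rep_dim s)" and QP: "Q * P = 1\<^sub>m (rep_dim r)"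
    and eq: "\<And>X. X \<in> GL2 \<Longrightarrow> P * rep_mat r X = rep_mat s X * P"
  shows "frag_of s - frag_of r \<in> exact_relations"
proof -
  have z: "rep_dim (zero_rep :: 'a rep) = 0" "rep_mat (zero_rep :: 'a rep) X = 1\<^sub>m 0" for X
    by (simp_all add: rep_dim.rep_eq rep_mat.rep_eq zero_rep.rep_eq)
  have empty: "A = B" if "A \<in> carrier_mat 0 n" "B \<in> carrier_mat 0 n" for A B :: "'a mat" and n
    using that by (intro eq_matI) auto
  have "rep_short_exact r s (zero_rep :: 'a rep)"
    unfolding rep_short_exact_iff
  proof (intro exI conjI ballI)
    show "split_exact P (0\<^sub>m 0 (rep_dim s)) Q (0\<^sub>m (rep_dim s) 0)
        (rep_dim r) (rep_dim s) (rep_dim (zero_rep :: 'a rep))"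
      using P Q PQ QP by (auto simp: split_exact_def z intro!: empty eq_matI)
  next
    fix X :: "'a mat" assume X: "X \<in> GL2"
    show "0\<^sub>m 0 (rep_dim s) * rep_mat s X = rep_mat zero_rep X * 0\<^sub>m 0 (rep_dim s)"
      using rep_mat_carrier[OF X, of s] by (intro empty) (auto simp: z)
  qed (rule eq)
  then have "frag_of s - frag_of r - frag_of zero_rep \<in> exact_relations"
    by (rule exact_relations.exact)
  moreover have "rep_short_exact zero_rep zero_rep (zero_rep :: 'a rep)"
    unfolding rep_short_exact_iff
    by (rule exI[of _ "1\<^sub>m 0"])+ (auto simp: split_exact_def z intro: empty)
  then have "frag_of (zero_rep :: 'a rep) - frag_of zero_rep - frag_of zero_rep \<in> exact_relations"
    by (rule exact_relations.exact)
  then have "frag_of (zero_rep :: 'a rep) \<in> exact_relations"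
    using exact_relations_uminus by fastforce
  ultimately show ?thesis
    using exact_relations_add by fastforce
qed

lemma exact_relations_perm:
  fixes r s :: "'a::field rep"
  assumes dim: "rep_dim s = rep_dim r" and bij: "bij_betw f {..<rep_dim r} {..<rep_dim r}"
    and eq: "\<And>X i j. X \<in> GL2 \<Longrightarrow> i < rep_dim r \<Longrightarrow> j < rep_dim r \<Longrightarrow>
      rep_mat s X $$ (f i, f j) = rep_mat r X $$ (i, j)"
  shows "frag_of s - frag_of r \<in> exact_relations"
proof (rule exact_relations_iso)
  define n where "n = rep_dim r"
  define P Q where "P = mat n n (\<lambda>(i, j). if i = f j then 1 else 0 :: 'a)"
    and "Q = mat n n (\<lambda>(i, j). if f i = j then 1 else 0 :: 'a)"
  have f: "f i < n" "f i = f j \<longleftrightarrow> i = j" if "i < n" "j < n" for i j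
    using bij that by (auto simp: bij_betw_def n_def inj_on_eq_iff)
  have surj: "\<exists>i<n. j = f i" if "j < n" for j
    using bij that by (auto simp: bij_betw_def n_def)
  show "P \<in> carrier_mat (rep_dim s) (rep_dim r)" "Q \<in> carrier_mat (rep_dim r) (rep_dim s)"
    by (simp_all add: P_def Q_def n_def dim)
  have if_mult: "(if b then 1 else 0) * x = (if b then x else 0)"
    "x * (if b then 1 else 0) = (if b then x else 0)" for b and x :: 'a
    by simp_all
  have Q_left: "(Q * M) $$ (i, j) = M $$ (f i, j)"
    if "M \<in> carrier_mat n n" "i < n" "j < n" for M i j
    using that f(1)[OF that(2)]
    by (simp add: Q_def scalar_prod_def if_mult sum.delta lessThan_atLeast0[symmetric])
  have P_right: "(M * P) $$ (i, j) = M $$ (i, f j)"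
    if "M \<in> carrier_mat n n" "i < n" "j < n" for M i j
    using that f(1)[OF that(3)]
    by (simp add: P_def scalar_prod_def if_mult sum.delta lessThan_atLeast0[symmetric])
  have P: "P \<in> carrier_mat n n" and Q: "Q \<in> carrier_mat n n" by (simp_all add: P_def Q_def)
  have QP: "Q * P = 1\<^sub>m n"
    using P Q f by (intro eq_matI) (auto simp: Q_left[OF P] simp del: index_mult_mat(1), auto simp: P_def)
  show "Q * P = 1\<^sub>m (rep_dim r)" using QP by (simp add: n_def)
  show "P * Q = 1\<^sub>m (rep_dim s)"
    using mat_mult_left_right_inverse[OF Q P QP] by (simp add: n_def dim)
  fix X :: "'a mat" assume X: "X \<in> GL2"
  note r = rep_mat_carrier[OF X, of r, folded n_def]
    and s = rep_mat_carrier[OF X, of s, unfolded dim, folded n_def]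
  have Pr: "P * rep_mat r X \<in> carrier_mat n n" and sP: "rep_mat s X * P \<in> carrier_mat n n"
    using P r s by auto
  have "Q * (rep_mat s X * P) = rep_mat r X"
    using P Q sP r eq[OF X] f
    by (intro eq_matI) (simp_all add: Q_left[OF sP] P_right[OF s] n_def del: index_mult_mat(1))
  then have "P * rep_mat r X = (P * Q) * (rep_mat s X * P)"
    using assoc_mult_mat[OF P Q sP] by simp
  also have "\<dots> = rep_mat s X * P"
    unfolding mat_mult_left_right_inverse[OF Q P QP] by (rule left_mult_one_mat[OF sP])
  finally show "P * rep_mat r X = rep_mat s X * P" .
qed


lemma rep_tensor_comm: "frag_of (rep_tensor r s) - frag_of (rep_tensor s r) \<in> exact_relations"
proof -
  define n m where "n = rep_dim r" and "m = rep_dim s"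
  define f where "f = (\<lambda>i. (i mod n) * m + i div n)"
  have inv: "f i div m = i mod n" "f i mod m = i div n" if "i < m * n" for i
    using div_mod_bound[OF that] by (simp_all add: f_def)
  show ?thesis
  proof (rule exact_relations_perm)
    show "rep_dim (rep_tensor r s) = rep_dim (rep_tensor s r)" by simp
    have "bij_betw f {..<m * n} {..<m * n}"
    proof (rule bij_betw_byWitness[where f' = "\<lambda>i. (i mod m) * n + i div m"])
      show "\<forall>i\<in>{..<m * n}. f i mod m * n + f i div m = i" by (auto simp: inv)
      show "\<forall>i\<in>{..<m * n}. f ((i mod m) * n + i div m) = i"
      proof
        fix i assume "i \<in> {..<m * n}"
        then have "i < n * m" by (simp add: mult.commute)
        from div_mod_bound[OF this] show "f ((i mod m) * n + i div m) = i"
          by (simp add: f_def)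
      qed
      show "f ` {..<m * n} \<subseteq> {..<m * n}"
      proof safe
        fix i assume "i < m * n"
        from div_mod_bound[OF this] show "f i < m * n"
          using mult_add_bound[of "i mod n" n "i div n" m] by (simp add: f_def mult.commute[of m n])
      qed
      show "(\<lambda>i. (i mod m) * n + i div m) ` {..<m * n} \<subseteq> {..<m * n}"
      proof safe
        fix i assume "i < m * n"
        then have "i < n * m" by (simp add: mult.commute)
        from div_mod_bound[OF this] show "(i mod m) * n + i div m < m * n"
          by (simp add: mult_add_bound)
      qed
    qed
    then show "bij_betw f {..<rep_dim (rep_tensor s r)} {..<rep_dim (rep_tensor s r)}"
      by (simp add: n_def m_def)
    fix X :: "'a mat" and i j
    assume X: "X \<in> GL2" and ij: "i < rep_dim (rep_tensor s r)" "j < rep_dim (rep_tensor s r)"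
    then have i: "i < m * n" and j: "j < m * n" by (simp_all add: n_def m_def)
    have "f i < n * m" "f j < n * m"
      using div_mod_bound[OF i] div_mod_bound[OF j] by (simp_all add: f_def mult_add_bound)
    then show "rep_mat (rep_tensor r s) X $$ (f i, f j) = rep_mat (rep_tensor s r) X $$ (i, j)"
      using i j rep_mat_carrier[OF X, of r, folded n_def] rep_mat_carrier[OF X, of s, folded m_def]
      by (simp add: kron_def inv mult.commute)
  qed
qed

lemma rep_eqI_perm:
  assumes "rep_dim s = rep_dim r"
    and "\<And>X i j. X \<in> GL2 \<Longrightarrow> i < rep_dim r \<Longrightarrow> j < rep_dim r \<Longrightarrow>
      rep_mat s X $$ (i, j) = rep_mat r X $$ (i, j)"
  shows "frag_of s - frag_of r \<in> exact_relations"
  using exact_relations_perm[of s r id] assms by simp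

lemma rep_tensor_assoc:
  "frag_of (rep_tensor (rep_tensor r s) t) - frag_of (rep_tensor r (rep_tensor s t)) \<in> exact_relations"
proof (rule rep_eqI_perm)
  fix X :: "'a mat" and i j
  assume X: "X \<in> GL2" and ij: "i < rep_dim (rep_tensor r (rep_tensor s t))"
    "j < rep_dim (rep_tensor r (rep_tensor s t))"
  have *: "k div (b * c) = k div c div b" "k mod (b * c) div c = k div c mod b"
    "k mod (b * c) mod c = k mod c" for k b c :: nat
    by (simp_all add: div_mult2_eq mult.commute[of b c] mod_mult2_eq)
       (cases "c = 0"; simp)
  note c = carrier_matD[OF rep_mat_carrier[OF X]]
  have i: "i < rep_dim r * (rep_dim s * rep_dim t)" and j: "j < rep_dim r * (rep_dim s * rep_dim t)"
    using ij by simp_all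
  have bnd: "k div rep_dim t < rep_dim r * rep_dim s" "k mod (rep_dim s * rep_dim t) < rep_dim s * rep_dim t"
    if "k < rep_dim r * (rep_dim s * rep_dim t)" for k
    using that div_mod_bound(1)[of k "rep_dim r * rep_dim s" "rep_dim t"] div_mod_bound[OF that]
    by (simp_all add: mult.assoc)
  show "rep_mat (rep_tensor (rep_tensor r s) t) X $$ (i, j) =
      rep_mat (rep_tensor r (rep_tensor s t)) X $$ (i, j)"
    using i j bnd[OF i] bnd[OF j] by (simp add: kron_def c mult.assoc[symmetric] *)
qed simp

lemma rep_tensor_triv: "frag_of (rep_tensor triv_rep r) - frag_of r \<in> exact_relations"
proof -
  have t: "rep_dim (triv_rep :: 'a rep) = 1" "rep_mat (triv_rep :: 'a rep) X = 1\<^sub>m 1" for X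
    by (simp_all add: rep_dim.rep_eq rep_mat.rep_eq triv_rep.rep_eq)
  show ?thesis
  proof (rule rep_eqI_perm)
    fix X :: "'a mat" and i j
    assume "X \<in> GL2" "i < rep_dim r" "j < rep_dim r"
    then show "rep_mat (rep_tensor triv_rep r) X $$ (i, j) = rep_mat r X $$ (i, j)"
      using rep_mat_carrier[of X r] by (simp add: kron_def t)
  qed (simp add: t)
qed

text \<open>The dimension, as an element of the field, is additive on short exact sequences because
  it is a trace.  This suffices to see that the ring is not trivial.\<close>

definition mat_tr :: "'a::comm_ring_1 mat \<Rightarrow> 'a"
  where "mat_tr A = (\<Sum>i<dim_row A. A $$ (i, i))"

lemma mat_tr_comm:
  assumes "A \<in> carrier_mat m n" "B \<in> carrier_mat n m"
  shows "mat_tr (A * B) = mat_tr (B * A)"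
proof -
  have "mat_tr (A * B) = (\<Sum>i<m. \<Sum>k<n. A $$ (i, k) * B $$ (k, i))"
    using assms by (simp add: mat_tr_def scalar_prod_def lessThan_atLeast0)
  also have "\<dots> = (\<Sum>k<n. \<Sum>i<m. A $$ (i, k) * B $$ (k, i))" by (rule sum.swap)
  also have "\<dots> = mat_tr (B * A)"
    using assms by (simp add: mat_tr_def scalar_prod_def lessThan_atLeast0 mult.commute)
  finally show ?thesis .
qed

lemma mat_tr_add:
  "A \<in> carrier_mat n n \<Longrightarrow> B \<in> carrier_mat n n \<Longrightarrow> mat_tr (A + B) = mat_tr A + mat_tr B"
  by (simp add: mat_tr_def sum.distrib)

lemma rep_short_exact_dim:
  assumes "rep_short_exact r' r (r'' :: 'a::field rep)"
  shows "(of_nat (rep_dim r) :: 'a) = of_nat (rep_dim r') + of_nat (rep_dim r'')"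
proof -
  have one: "mat_tr (1\<^sub>m n :: 'a mat) = of_nat n" for n by (simp add: mat_tr_def)
  obtain A B L R :: "'a mat" where
    s: "split_exact A B L R (rep_dim r') (rep_dim r) (rep_dim r'')"
    using assms unfolding rep_short_exact_iff by blast
  then have sum: "mat_tr (A * L + R * B) = mat_tr (A * L) + mat_tr (R * B)"
    by (intro mat_tr_add[of _ "rep_dim r"]) (auto simp: split_exact_def)
  have "mat_tr (A * L) = mat_tr (L * A)" "mat_tr (R * B) = mat_tr (B * R)"
    using s mat_tr_comm[of A "rep_dim r" "rep_dim r'" L] mat_tr_comm[of R "rep_dim r" "rep_dim r''" B]
    by (simp_all only: split_exact_def simp_thms)
  with sum s show ?thesis by (simp add: split_exact_def one)
qed

definition free_dim :: "('a::field rep \<Rightarrow>\<^sub>0 int) \<Rightarrow> 'a"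
  where "free_dim x = of_int (poly_mapping.lookup
    (frag_extend (\<lambda>r. frag_cmul (int (rep_dim r)) (frag_of ())) x) ())"

lemma free_dim_exact: "x \<in> exact_relations \<Longrightarrow> free_dim x = 0"
proof (induction rule: exact_relations.induct)
  case (exact r' r r'')
  then show ?case
    using rep_short_exact_dim[OF exact] by (simp add: free_dim_def frag_extend_diff lookup_minus)
qed (simp_all add: free_dim_def frag_extend_diff lookup_minus)

instantiation K0 :: (finite_field) comm_ring_1
begin

lift_definition zero_K0 :: "'a K0" is 0 .

lift_definition one_K0 :: "'a K0" is "frag_of triv_rep" .

lift_definition plus_K0 :: "'a K0 \<Rightarrow> 'a K0 \<Rightarrow> 'a K0" is "(+)"
  using exact_relations_add by (fastforce simp: algebra_simps)

lift_definition uminus_K0 :: "'a K0 \<Rightarrow> 'a K0" is uminus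
  using exact_relations_uminus by fastforce

lift_definition minus_K0 :: "'a K0 \<Rightarrow> 'a K0 \<Rightarrow> 'a K0" is "(-)"
  using exact_relations.diff by (fastforce simp: algebra_simps)

lift_definition times_K0 :: "'a K0 \<Rightarrow> 'a K0 \<Rightarrow> 'a K0" is free_tensor
proof -
  fix x x' y y' :: "'a rep \<Rightarrow>\<^sub>0 int"
  assume "x - x' \<in> exact_relations" "y - y' \<in> exact_relations"
  then have "free_tensor (x - x') y + free_tensor x' (y - y') \<in> exact_relations"
    by (intro exact_relations_add free_tensor_exact_left free_tensor_exact_right)
  then show "free_tensor x y - free_tensor x' y' \<in> exact_relations"
    by (simp add: free_tensor_diff_left free_tensor_diff_right)
qed

instance
proof
  note z = exact_relations.zero
  have fadd: "free_tensor (x + y) w = free_tensor x w + free_tensor y w" for x y w :: "'a rep \<Rightarrow>\<^sub>0 int"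
    by (simp add: free_tensor_def frag_extend_add)
  fix a b c :: "'a K0"
  show "a + b + c = a + (b + c)" by transfer (simp add: z algebra_simps)
  show "a + b = b + a" by transfer (simp add: z algebra_simps)
  show "0 + a = a" by transfer (simp add: z)
  show "- a + a = 0" by transfer (simp add: z)
  show "a - b = a + - b" by transfer (simp add: z)
  show "a * b * c = a * (b * c)"
  proof transfer
    fix x y w :: "'a rep \<Rightarrow>\<^sub>0 int"
    show "free_tensor (free_tensor x y) w - free_tensor x (free_tensor y w) \<in> exact_relations"
    proof (induction x rule: free_induct)
      case (one r)
      show ?case
      proof (induction y rule: free_induct)
        case (one s)
        show ?case
        proof (induction w rule: free_induct)
          case (one t)
          show ?case by (simp add: rep_tensor_assoc)
        next
          case (diff u v)
          from exact_relations.diff[OF this] show ?case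
            by (simp only: free_tensor_diff_right free_tensor_diff_left diff_diff_eq_swap)
        qed (simp add: z)
      next
        case (diff u v)
        from exact_relations.diff[OF this] show ?case
          by (simp only: free_tensor_diff_right free_tensor_diff_left diff_diff_eq_swap)
      qed (simp add: z)
    next
      case (diff u v)
      from exact_relations.diff[OF this] show ?case
        by (simp only: free_tensor_diff_left diff_diff_eq_swap)
    qed (simp add: z)
  qed
  show "a * b = b * a"
  proof transfer
    fix x y :: "'a rep \<Rightarrow>\<^sub>0 int"
    show "free_tensor x y - free_tensor y x \<in> exact_relations"
    proof (induction x rule: free_induct)
      case (one r)
      show ?case
      proof (induction y rule: free_induct)
        case (one s)
        show ?case by (simp add: rep_tensor_comm)
      next
        case (diff u v)
        from exact_relations.diff[OF this] show ?case
          by (simp only: free_tensor_diff_right free_tensor_diff_left diff_diff_eq_swap)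
      qed (simp add: z)
    next
      case (diff u v)
      from exact_relations.diff[OF this] show ?case
        by (simp only: free_tensor_diff_right free_tensor_diff_left diff_diff_eq_swap)
    qed (simp add: z)
  qed
  show "1 * a = a"
  proof transfer
    fix x :: "'a rep \<Rightarrow>\<^sub>0 int"
    show "free_tensor (frag_of triv_rep) x - x \<in> exact_relations"
    proof (induction x rule: free_induct)
      case (one r)
      show ?case by (simp add: rep_tensor_triv)
    next
      case (diff u v)
      from exact_relations.diff[OF this] show ?case
        by (simp only: free_tensor_diff_right diff_diff_eq_swap)
    qed (simp add: z)
  qed
  show "(a + b) * c = a * c + b * c" by transfer (simp add: z fadd)
  show "(0 :: 'a K0) \<noteq> 1"
  proof
    assume "(0 :: 'a K0) = 1"
    then have "0 - frag_of (triv_rep :: 'a rep) \<in> exact_relations" by transfer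
    from free_dim_exact[OF this] have "rep_dim (triv_rep :: 'a rep) \<noteq> 1"
      by (auto simp: free_dim_def frag_extend_diff frag_extend_minus)
    then show False
      by (simp add: rep_dim.rep_eq triv_rep.rep_eq)
  qed
qed

end

subsection \<open>Frobenius twists and the basic classes\<close>

lift_definition K0_twist :: "int \<Rightarrow> 'a::finite_field K0 \<Rightarrow> 'a K0" is
  "\<lambda>n. frag_extend (\<lambda>r. frag_of (rep_twist n r))"
proof -
  fix n and x y :: "'a rep \<Rightarrow>\<^sub>0 int"
  assume "x - y \<in> exact_relations"
  then have "frag_extend (\<lambda>r. frag_of (rep_twist n r)) (x - y) \<in> exact_relations"
    by induction (auto simp: frag_extend_diff intro: exact_relations.intros rep_short_exact_twist)
  then show "frag_extend (\<lambda>r. frag_of (rep_twist n r)) x -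
      frag_extend (\<lambda>r. frag_of (rep_twist n r)) y \<in> exact_relations"
    by (simp add: frag_extend_diff)
qed

text \<open>Powers of the class of the determinant character, for arbitrary integer exponents.\<close>

definition K0_det :: "int \<Rightarrow> 'a::finite_field K0"
  where "K0_det m = K0_class (det_rep m)"

definition K0_sym :: "int \<Rightarrow> 'a::finite_field K0"
  where "K0_sym k = (if 0 \<le> k then K0_class (sym_rep (nat k))
    else if k = - 1 then 0
    else - (K0_det (1 + k) * K0_class (sym_rep (nat (- k - 2)))))"

section \<open>Formal expressions and computations with families of identities\<close>

text \<open>\<open>Det m\<close> stands for the \<open>m\<close>-th power of the class \<open>e\<close> of the determinant, \<open>Sym k\<close> for
  the (virtual) symmetric power with index \<open>k\<close>, and \<open>Cst c\<close> for an integer constant.\<close>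

datatype vexpr =
    Cst int
  | Det int
  | Sym int
  | Twist int vexpr
  | Neg vexpr
  | Add vexpr vexpr (infixl \<open>\<^bold>+\<close> 65)
  | Mul vexpr vexpr (infixl \<open>\<^bold>*\<close> 70)

primrec K0_val :: "vexpr \<Rightarrow> 'a::finite_field K0" where
  "K0_val (Cst c) = of_int c"
| "K0_val (Det m) = K0_det m"
| "K0_val (Sym k) = K0_sym k"
| "K0_val (Twist n x) = K0_twist n (K0_val x)"
| "K0_val (Neg x) = - K0_val x"
| "K0_val (x \<^bold>+ y) = K0_val x + K0_val y"
| "K0_val (x \<^bold>* y) = K0_val x * K0_val y"

definition Delta :: "(vexpr \<times> vexpr) set"
  where "Delta = {(Sym k, Neg (Det (1 + k) \<^bold>* Sym (- k - 2))) | k. True}"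

definition Phi :: "nat \<Rightarrow> (vexpr \<times> vexpr) set"
  where "Phi p = {(Sym k,
    Sym (k - int p) \<^bold>* Twist 1 (Sym 1) \<^bold>+ Neg (Det (int p) \<^bold>* Sym (k - 2 * int p))) | k. True}"

definition Pi_rel :: "(vexpr \<times> vexpr) set"
  where "Pi_rel = {(Sym n \<^bold>* Sym m,
    Sym (n + m) \<^bold>+ Det 1 \<^bold>* Sym (n - 1) \<^bold>* Sym (m - 1)) | n m. True}"

text \<open>\<open>computes p g I x y\<close>: the expression \<open>x\<close> can be transformed into \<open>y\<close> by finitely many
  applications, in arbitrary positions, of the identities in \<open>I\<close>, of the two periodicities
  \<open>e\<^bsup>q - 1\<^esup> = 1\<close> and \<open>\<sigma>\<^bsup>g\<^esup> = 1\<close> (with \<open>q = p\<^bsup>g\<^esup>\<close>), and of the rules of calculation in a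
  commutative ring with a unit \<open>e\<close> on which the integers act by ring automorphisms such that,
  for \<open>n \<ge> 0\<close>, the \<open>n\<close>-th twist of \<open>e\<close> is the \<open>p\<^bsup>n\<^esup>\<close>-th power of \<open>e\<close>.\<close>

inductive computes :: "nat \<Rightarrow> nat \<Rightarrow> (vexpr \<times> vexpr) set \<Rightarrow> vexpr \<Rightarrow> vexpr \<Rightarrow> bool"
  for p g :: nat and I :: "(vexpr \<times> vexpr) set" where
  identity: "(x, y) \<in> I \<Longrightarrow> computes p g I x y"
| det_order: "computes p g I (Det (int p ^ g - 1)) (Cst 1)"
| twist_order: "computes p g I (Twist (n + int g) x) (Twist n x)"
  \<comment> \<open>equivalence and congruence\<close>
| refl: "computes p g I x x"
| sym: "computes p g I x y \<Longrightarrow> computes p g I y x"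
| trans: "computes p g I x y \<Longrightarrow> computes p g I y z \<Longrightarrow> computes p g I x z"
| cong_add: "computes p g I x x' \<Longrightarrow> computes p g I y y' \<Longrightarrow> computes p g I (x \<^bold>+ y) (x' \<^bold>+ y')"
| cong_mul: "computes p g I x x' \<Longrightarrow> computes p g I y y' \<Longrightarrow> computes p g I (x \<^bold>* y) (x' \<^bold>* y')"
| cong_neg: "computes p g I x x' \<Longrightarrow> computes p g I (Neg x) (Neg x')"
| cong_twist: "computes p g I x x' \<Longrightarrow> computes p g I (Twist n x) (Twist n x')"
  \<comment> \<open>commutative ring with integer constants\<close>
| add_assoc: "computes p g I (x \<^bold>+ y \<^bold>+ z) (x \<^bold>+ (y \<^bold>+ z))"
| add_commute: "computes p g I (x \<^bold>+ y) (y \<^bold>+ x)"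
| add_zero: "computes p g I (Cst 0 \<^bold>+ x) x"
| add_neg: "computes p g I (Neg x \<^bold>+ x) (Cst 0)"
| mul_assoc: "computes p g I (x \<^bold>* y \<^bold>* z) (x \<^bold>* (y \<^bold>* z))"
| mul_commute: "computes p g I (x \<^bold>* y) (y \<^bold>* x)"
| mul_one: "computes p g I (Cst 1 \<^bold>* x) x"
| distrib: "computes p g I ((x \<^bold>+ y) \<^bold>* z) (x \<^bold>* z \<^bold>+ y \<^bold>* z)"
| cst_add: "computes p g I (Cst (a + b)) (Cst a \<^bold>+ Cst b)"
  \<comment> \<open>powers of \<open>e\<close>\<close>
| det_zero: "computes p g I (Det 0) (Cst 1)"
| det_add: "computes p g I (Det (m + n)) (Det m \<^bold>* Det n)"
  \<comment> \<open>Frobenius twists\<close>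
| twist_zero: "computes p g I (Twist 0 x) x"
| twist_twist: "computes p g I (Twist m (Twist n x)) (Twist (m + n) x)"
| twist_add: "computes p g I (Twist n (x \<^bold>+ y)) (Twist n x \<^bold>+ Twist n y)"
| twist_mul: "computes p g I (Twist n (x \<^bold>* y)) (Twist n x \<^bold>* Twist n y)"
| twist_one: "computes p g I (Twist n (Cst 1)) (Cst 1)"
| twist_det: "computes p g I (Twist (int n) (Det m)) (Det (int p ^ n * m))"

text \<open>\<open>basic_expr m k g\<close> is the product of \<open>Det m\<close> and of all \<open>Twist i (Sym (k i))\<close>
  with \<open>i < g\<close>.\<close>

primrec basic_expr :: "int \<Rightarrow> (nat \<Rightarrow> int) \<Rightarrow> nat \<Rightarrow> vexpr" where
  "basic_expr m k 0 = Det m"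
| "basic_expr m k (Suc g) = basic_expr m k g \<^bold>* Twist (int g) (Sym (k g))"

inductive product_expr :: "nat \<Rightarrow> vexpr \<Rightarrow> bool" for g :: nat where
  "product_expr g (basic_expr m k g)"
| "product_expr g x \<Longrightarrow> product_expr g y \<Longrightarrow> product_expr g (x \<^bold>* y)"

inductive algebraic_sum :: "nat \<Rightarrow> vexpr \<Rightarrow> bool" for g :: nat where
  "algebraic_sum g (Cst 0)"
| "product_expr g x \<Longrightarrow> algebraic_sum g x"
| "algebraic_sum g x \<Longrightarrow> algebraic_sum g (Neg x)"
| "algebraic_sum g x \<Longrightarrow> algebraic_sum g y \<Longrightarrow> algebraic_sum g (x \<^bold>+ y)"

primrec combination ::
  "nat \<Rightarrow> (nat \<Rightarrow> int) \<Rightarrow> (nat \<Rightarrow> int) \<Rightarrow> (nat \<Rightarrow> nat \<Rightarrow> int) \<Rightarrow> nat \<Rightarrow> vexpr" where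
  "combination g n m k 0 = Cst 0"
| "combination g n m k (Suc N) =
    combination g n m k N \<^bold>+ Cst (n N) \<^bold>* basic_expr (m N) (k N) g"

text \<open>The element of the Grothendieck ring given by the expression \<open>x\<close> can be brought into
  standard form using the identities in \<open>I\<close>.  The finite index set is \<open>{..<N}\<close>.\<close>

definition JH_computable ::
  "'a::finite_field itself \<Rightarrow> nat \<Rightarrow> nat \<Rightarrow> (vexpr \<times> vexpr) set \<Rightarrow> vexpr \<Rightarrow> bool"
  where "JH_computable F p g I x \<longleftrightarrow>
    (\<exists>(N :: nat) (n :: nat \<Rightarrow> int) (m :: nat \<Rightarrow> int) (k :: nat \<Rightarrow> nat \<Rightarrow> int).
      (\<forall>j<N. n j \<noteq> 0 \<and> 0 \<le> m j \<and> m j < int p ^ g - 1 \<and>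
        (\<forall>i<g. 0 \<le> k j i \<and> k j i \<le> int p - 1)) \<and>
      (\<forall>j<N. \<forall>j'<N. j \<noteq> j' \<longrightarrow> m j \<noteq> m j' \<or> (\<exists>i<g. k j i \<noteq> k j' i)) \<and>
      computes p g I x (combination g n m k N) \<and>
      (K0_val x :: 'a K0) =
        (\<Sum>j<N. of_int (n j) * (K0_det (m j) * (\<Prod>i<g. K0_twist (int i) (K0_sym (k j i))))))"

end

theory Submission
  imports Defs
begin

text \<open>
  In the Grothendieck ring, \<open>(\<Delta>)\<close> is the definition of the classes of negative index.
  Given \<open>(\<Delta>)\<close> and the exact sequence
  \<open>0 \<rightarrow> e \<otimes> Sym\<^bsup>k - 1\<^esup> \<rightarrow> Sym\<^sup>1 \<otimes> Sym\<^sup>k \<rightarrow> Sym\<^bsup>k + 1\<^esup> \<rightarrow> 0\<close>,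
  the recursion \<open>M\<^sub>1 M\<^sub>k = M\<^bsub>k + 1\<^esub> + e M\<^bsub>k - 1\<^esub>\<close> holds for all integers \<open>k\<close>.
  The defects of \<open>(\<Pi>)\<close> and \<open>(\<Phi>)\<close> satisfy the same linear recursion, so each need only
  vanish at two consecutive indices.  For \<open>(\<Phi>)\<close> these are \<open>p - 1\<close>, where the defect vanishes
  trivially, and \<open>p\<close>, which is the exact sequence
  \<open>0 \<rightarrow> (Sym\<^sup>1)\<^bsup>[1]\<^esup> \<rightarrow> Sym\<^sup>p \<rightarrow> e \<otimes> Sym\<^bsup>p - 2\<^esup> \<rightarrow> 0\<close>.

  For the computation, \<open>(\<Pi>)\<close> and \<open>(\<Delta>)\<close> give \<open>M\<^bsub>-1\<^esub> = 0\<close>, hence \<open>M\<^sub>0\<close> acts as a unit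
  on every \<open>M\<^sub>k\<close> and multiplication by \<open>M\<^sub>n\<close> reduces to multiplication by \<open>M\<^sub>1\<close>.
  An index \<open>k \<ge> p\<close> is lowered by \<open>(\<Phi>)\<close> at the cost of a factor \<open>M\<^sub>1\<close> in the cyclically
  next slot, where \<open>M\<^sub>k M\<^sub>1 = M\<^bsub>k + 1\<^esub> + e M\<^bsub>k - 1\<^esub>\<close> absorbs it.  The sum of the indices
  decreases, so the process ends.
\<close>

section \<open>Twists and determinants in the Grothendieck ring\<close>

text \<open>Frobenius powers are injective, so this equation pins down
  \<open>frob (int a - int b) x\<close>. Writing an integer as a difference of naturals turns
  composition of Frobenius powers into arithmetic of ordinary powers, without sign cases.\<close>

lemma frob_power:
  fixes x :: "'a::finite_field"
  shows "frob (int a - int b) x ^ CHAR('a) ^ b = x ^ CHAR('a) ^ a"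
proof (cases "b \<le> a")
  case True
  then have "frob (int a - int b) x = x ^ CHAR('a) ^ (a - b)"
    by (simp add: frob_def nat_diff_distrib)
  then show ?thesis using True by (simp flip: power_mult power_add)
next
  case False
  define d where "d = b - a"
  have n: "int a - int b = - int d" "b = d + a" "d > 0" using False by (simp_all add: d_def)
  have "frob (int a - int b) x ^ CHAR('a) ^ d = x"
    using surj_f_inv_f[OF bij_is_surj[OF frob_power_bij[of d]], of x] n(3)
    by (simp add: n(1) frob_def)
  then show ?thesis
    by (simp add: n(2) power_add power_mult)
qed

lemma frob_eqI:
  fixes x :: "'a::finite_field"
  assumes "y ^ CHAR('a) ^ b = x ^ CHAR('a) ^ a"
  shows "frob (int a - int b) x = y"
proof -
  have "inj (\<lambda>x::'a. x ^ CHAR('a) ^ b)" using frob_power_bij by (rule bij_is_inj)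
  from injD[OF this, of "frob (int a - int b) x" y] show ?thesis
    using frob_power[of a b x] assms by simp
qed

lemma int_diff_cases: obtains a b where "n = int a - int b"
proof
  show "n = int (nat n) - int (nat (- n))" by simp
qed

lemma frob_frob: "frob m (frob n x) = frob (m + n) (x :: 'a::finite_field)"
proof -
  obtain a b where m: "m = int a - int b" by (rule int_diff_cases)
  obtain c d where n: "n = int c - int d" by (rule int_diff_cases)
  have "frob m (frob n x) ^ CHAR('a) ^ (b + d) = (frob m (frob n x) ^ CHAR('a) ^ b) ^ CHAR('a) ^ d"
    by (simp add: power_mult power_add)
  also have "\<dots> = (frob n x ^ CHAR('a) ^ d) ^ CHAR('a) ^ a"
    unfolding m frob_power by (simp flip: power_mult add: mult.commute)
  also have "\<dots> = x ^ CHAR('a) ^ (a + c)"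
    unfolding n frob_power by (simp flip: power_mult power_add add: add.commute)
  finally have "frob (int (a + c) - int (b + d)) x = frob m (frob n x)" by (rule frob_eqI)
  then show ?thesis by (simp add: m n algebra_simps)
qed

lemma frob_0: "frob 0 x = x"
  by (simp add: frob_def)

lemma frob_nat: "frob (int n) x = x ^ CHAR('a) ^ n" for x :: "'a::finite_field"
  by (simp add: frob_def)

lemma frob_order:
  fixes x :: "'a::finite_field"
  assumes "CARD('a) = CHAR('a) ^ g"
  shows "frob (n + int g) x = frob n x"
  using finite_field_power_card_eq_same[of x] by (simp add: frob_nat assms flip: frob_frob)

section \<open>Classes of representations and induction on the Grothendieck group\<close>

lemma rep_dim_simps [simp]:
  "rep_dim (det_rep m) = 1" "rep_dim (sym_rep k) = k + 1" "rep_dim triv_rep = 1"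
  "rep_dim (rep_twist n (r :: 'b::finite_field rep)) = rep_dim r"
  by (simp_all add: rep_dim.rep_eq det_rep.rep_eq sym_rep.rep_eq triv_rep.rep_eq
      rep_twist.rep_eq split: prod.split)

lemma rep_mat_simps [simp]:
  "rep_mat (det_rep m) X = mat 1 1 (\<lambda>_. det X powi m)" "rep_mat (sym_rep k) X = sym_mat k X"
  "rep_mat triv_rep X = 1\<^sub>m 1"
  "rep_mat (rep_twist n (r :: 'b::finite_field rep)) Y = rep_mat r (map_mat (frob n) Y)"
  by (simp_all add: rep_mat.rep_eq det_rep.rep_eq sym_rep.rep_eq triv_rep.rep_eq
      rep_twist.rep_eq split: prod.split)

lemma K0_class_exact:
  "rep_short_exact r' r r'' \<Longrightarrow> K0_class r = K0_class r' + K0_class r''"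
  by transfer (metis exact_relations.exact diff_diff_eq)

lemma K0_class_eqI:
  fixes r s :: "'a::finite_field rep"
  assumes "rep_dim s = rep_dim r" "\<And>X. X \<in> GL2 \<Longrightarrow> rep_mat s X = rep_mat r X"
  shows "K0_class s = K0_class r"
proof -
  have "frag_of s - frag_of r \<in> exact_relations"
    by (rule rep_eqI_perm) (simp_all add: assms)
  then show ?thesis by transfer
qed

lemma K0_class_tensor: "K0_class (rep_tensor r s) = K0_class r * K0_class s"
  by transfer (simp add: exact_relations.zero)

lemma K0_class_triv: "K0_class triv_rep = 1"
  by transfer (simp add: exact_relations.zero)

text \<open>Classes of representations generate the group under subtraction, so identities between
  additive maps need checking on classes only, where representing matrices can be compared.\<close>

lemma K0_induct [case_names zero one diff]:
  fixes x :: "'a::finite_field K0"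
  assumes zero: "P 0" and one: "\<And>r. P (K0_class r)"
    and diff: "\<And>x y. P x \<Longrightarrow> P y \<Longrightarrow> P (x - y)"
  shows "P x"
proof (induction x rule: K0.abs_induct)
  case (1 f)
  show ?case
  proof (induction f rule: free_induct)
    case zero
    then show ?case using assms(1) by (simp add: zero_K0_def)
  next
    case (one r)
    then show ?case using assms(2)[of r] by (simp add: K0_class.abs_eq)
  next
    case (diff f h)
    then show ?case using assms(3) by (metis minus_K0.abs_eq)
  qed
qed

section \<open>Frobenius twists as ring homomorphisms\<close>

lemma K0_twist_class: "K0_twist n (K0_class r) = K0_class (rep_twist n r)"
  by transfer (simp add: exact_relations.zero)

lemma K0_twist_0_eq: "K0_twist n 0 = 0"
  by transfer (simp add: exact_relations.zero)

lemma K0_twist_diff: "K0_twist n (x - y) = K0_twist n x - K0_twist n y"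
  by transfer (simp add: frag_extend_diff exact_relations.zero)

lemma K0_twist_add: "K0_twist n (x + y) = K0_twist n x + K0_twist n y"
  using K0_twist_diff[of n x "0 - y"] K0_twist_diff[of n 0 y] by (simp add: K0_twist_0_eq)

lemma K0_twist_mult: "K0_twist n (x * y) = K0_twist n x * K0_twist n (y :: 'a::finite_field K0)"
proof (induction x rule: K0_induct)
  case (one r)
  show ?case
  proof (induction y rule: K0_induct)
    case (one s)
    show ?case
      by (simp add: K0_twist_class flip: K0_class_tensor) (rule K0_class_eqI; simp)
  qed (simp_all add: K0_twist_diff K0_twist_0_eq right_diff_distrib)
qed (simp_all add: K0_twist_diff K0_twist_0_eq left_diff_distrib)

lemma K0_twist_1: "K0_twist n 1 = 1"
  unfolding K0_class_triv[symmetric] K0_twist_class by (rule K0_class_eqI) simp_all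

lemma K0_twist_cong:
  assumes "\<And>x :: 'a::finite_field. frob m x = frob n x"
  shows "K0_twist m x = K0_twist n (x :: 'a K0)"
proof (induction x rule: K0_induct)
  case (one r)
  have "frob m = (frob n :: 'a \<Rightarrow> 'a)" using assms by blast
  then show ?case by (simp add: K0_twist_class) (rule K0_class_eqI; simp)
qed (simp_all add: K0_twist_diff K0_twist_0_eq)

lemma K0_twist_twist: "K0_twist m (K0_twist n x) = K0_twist (m + n) (x :: 'a::finite_field K0)"
proof (induction x rule: K0_induct)
  case (one r)
  \<comment> \<open>Twisting precomposes, so iterated twists reach the matrix in reversed order;
    this is harmless because the exponents add.\<close>
  have "map_mat (frob n) (map_mat (frob m) X) = map_mat (frob (m + n)) X" for X :: "'a mat"
    by (auto intro!: eq_matI simp: frob_frob add.commute)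
  then show ?case by (simp add: K0_twist_class) (rule K0_class_eqI; simp)
qed (simp_all add: K0_twist_diff K0_twist_0_eq)

lemma K0_twist_0: "K0_twist 0 x = (x :: 'a::finite_field K0)"
proof (induction x rule: K0_induct)
  case (one r)
  have "map_mat (frob 0) X = X" for X :: "'a mat" by (auto simp: frob_0)
  then show ?case by (simp add: K0_twist_class) (rule K0_class_eqI; simp)
qed (simp_all add: K0_twist_diff K0_twist_0_eq)

section \<open>Powers of the determinant and virtual symmetric powers\<close>

lemma GL2_det_nonzero: "X \<in> GL2 \<Longrightarrow> det X \<noteq> 0"
  by (auto simp: GL2_def invertible_mat_iff[of _ 2])
     (metis det_mult det_one mult_zero_left zero_neq_one)

lemma K0_det_0: "K0_det 0 = 1"
  unfolding K0_class_triv[symmetric] K0_det_def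
  by (rule K0_class_eqI) (auto intro!: eq_matI)

lemma K0_det_add: "K0_det (m + n) = K0_det m * K0_det n"
  unfolding K0_class_tensor[symmetric] K0_det_def
  by (rule K0_class_eqI)
     (auto intro!: eq_matI simp: kron_def power_int_add GL2_det_nonzero)

lemma K0_det_order: "K0_det (int CARD('a) - 1) = (1 :: 'a::finite_field K0)"
proof -
  have "x powi (int CARD('a) - 1) = 1" if "x \<noteq> 0" for x :: 'a
  proof -
    have "x powi (int CARD('a) - 1) * x = x powi (int CARD('a))"
      using power_int_add[of x "int CARD('a) - 1" 1] that by simp
    also have "\<dots> = x" by (simp add: finite_field_power_card_eq_same)
    finally show ?thesis using that by simp
  qed
  then show ?thesis
    unfolding K0_class_triv[symmetric] K0_det_def
    by (intro K0_class_eqI) (auto intro!: eq_matI simp: GL2_det_nonzero)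
qed

lemma K0_twist_det:
  "K0_twist (int n) (K0_det m) = (K0_det (int CHAR('a) ^ n * m) :: 'a::finite_field K0)"
proof -
  interpret comm_ring_hom "frob (int n) :: 'a \<Rightarrow> 'a" by (rule frob_hom)
  have pow: "x powi (int c ^ n) = x ^ c ^ n" for x :: 'a and c
    by (metis of_nat_power power_int_of_nat)
  show ?thesis
    unfolding K0_det_def K0_twist_class
    by (rule K0_class_eqI)
       (auto intro!: eq_matI simp: frob_nat power_int_mult hom_det pow)
qed

lemma K0_sym_nat: "K0_sym (int k) = K0_class (sym_rep k)"
  by (simp add: K0_sym_def)

lemma K0_sym_neg1: "K0_sym (- 1) = 0"
  by (simp add: K0_sym_def)

lemma K0_det_cancel: "K0_det m * (K0_det (- m) * x) = (x :: 'a::finite_field K0)"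
  using K0_det_add[of m "- m", where 'a = 'a] by (simp add: K0_det_0 flip: mult.assoc)

text \<open>For negative \<open>k\<close> this unfolds the definition. For nonnegative
  \<open>k\<close> the reflected index is at most -2, so unfolding it leads back to \<open>k\<close>
  with a second sign and the inverse power of the determinant.\<close>

lemma K0_sym_Delta:
  "K0_sym k = - (K0_det (1 + k) * K0_sym (- k - 2) :: 'a::finite_field K0)"
proof -
  consider "k \<ge> 0" | "k = - 1" | "k \<le> - 2" by linarith
  then show ?thesis
  proof cases
    case 1
    then show ?thesis
      using K0_det_cancel[of "1 + k" "K0_class (sym_rep (nat k)) :: 'a K0"]
      by (simp add: K0_sym_def minus_diff_commute)
  qed (auto simp: K0_sym_def)
qed

lemma sym_mat_0: "sym_mat 0 A = 1\<^sub>m 1"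
  by (auto simp: sym_mat_def intro!: eq_matI)

lemma K0_sym_0: "K0_sym 0 = (1 :: 'a::finite_field K0)"
  unfolding K0_class_triv[symmetric] K0_sym_nat[of 0, simplified]
  by (rule K0_class_eqI) (simp_all add: sym_mat_0)

section \<open>Two exact sequences of symmetric powers\<close>

text \<open>Keeping column \<open>j\<close> of \<open>sym_mat k X\<close> as a polynomial turns
  equivariance into identities between products of linear polynomials.\<close>

definition sym_col :: "nat \<Rightarrow> 'a::field mat \<Rightarrow> nat \<Rightarrow> 'a poly"
  where "sym_col k X j = [:X $$ (0, 0), X $$ (1, 0):] ^ (k - j) * [:X $$ (0, 1), X $$ (1, 1):] ^ j"

lemma sym_mat_index [simp]:
  "i \<le> k \<Longrightarrow> j \<le> k \<Longrightarrow> sym_mat k X $$ (i, j) = coeff (sym_col k X j) i"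
  by (simp add: sym_mat_def sym_col_def)

lemma sym_mat_carrier: "sym_mat k X \<in> carrier_mat (Suc k) (Suc k)"
  by (simp add: sym_mat_def)

lemma sym_mat_dim [simp]: "dim_row (sym_mat k X) = Suc k" "dim_col (sym_mat k X) = Suc k"
  by (simp_all add: sym_mat_def)

lemma coeff_sym_col_eq_0:
  assumes "j \<le> k" "k < i"
  shows "coeff (sym_col k X j) i = 0"
proof -
  have "degree (sym_col k X j) \<le> 1 * (k - j) + 1 * j"
    unfolding sym_col_def
    by (intro order_trans[OF degree_mult_le] add_mono order_trans[OF degree_power_le]
        mult_right_mono) auto
  then show ?thesis using assms by (intro coeff_eq_0) auto
qed

lemma sym_col_Suc:
  assumes "j \<le> k"
  shows "sym_col (Suc k) X j = [:X $$ (0, 0), X $$ (1, 0):] * sym_col k X j"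
    and "sym_col (Suc k) X (Suc j) = [:X $$ (0, 1), X $$ (1, 1):] * sym_col k X j"
  unfolding sym_col_def using assms by (simp_all only: Suc_diff_le power_Suc diff_Suc_Suc mult_ac)

lemma sym_mat_1:
  "a < 2 \<Longrightarrow> b < 2 \<Longrightarrow> sym_mat 1 X $$ (a, b) = X $$ (a, b)"
  by (auto simp: sym_col_def less_2_cases_iff)

lemma det_2:
  fixes X :: "'a::comm_ring_1 mat"
  assumes "X \<in> carrier_mat 2 2"
  shows "det X = X $$ (0, 0) * X $$ (1, 1) - X $$ (0, 1) * X $$ (1, 0)"
proof -
  have "det (mat_delete X i 0) = X $$ (1 - i, 1)" if "i < 2" for i
    using assms that det_single[of "mat_delete X i 0"]
    by (auto simp: mat_delete_def less_2_cases_iff)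
  then show ?thesis
    using assms by (simp add: laplace_expansion_column[of X 2 0] cofactor_def numeral_2_eq_2)
qed

lemma index_mult:
  assumes "A \<in> carrier_mat m n" "B \<in> carrier_mat n k" "i < m" "j < k"
  shows "(A * B) $$ (i, j) = (\<Sum>l<n. A $$ (i, l) * B $$ (l, j))"
  using assms by (simp add: scalar_prod_def lessThan_atLeast0)

lemma div_mod_add_left:
  "c < n \<Longrightarrow> (n + c) div n = 1" "c < n \<Longrightarrow> (n + c) mod n = c" for c n :: nat
  by (auto simp: div_add_self1)

lemma less_double_cases:
  fixes i n :: nat
  assumes "i < 2 * n"
  obtains "i < n" | a where "a < n" "i = n + a"
  using assms by (metis add_less_cancel_left le_add_diff_inverse mult_2 not_less)

section \<open>The Clebsch-Gordan sequence\<close>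

text \<open>In the Kronecker product of the standard representation and the symmetric power of degree
  \<open>n - 1\<close>, the index \<open>b * n + a\<close> belongs to \<open>e\<^sub>b \<otimes> e\<^sub>0\<^bsup>n - 1 - a\<^esup> e\<^sub>1\<^bsup>a\<^esup>\<close>.  The map
  \<open>cg_in\<close> is \<open>f \<mapsto> e\<^sub>1 \<otimes> e\<^sub>0 f - e\<^sub>0 \<otimes> e\<^sub>1 f\<close>, the map \<open>cg_out\<close> is multiplication, and the other
  two split them linearly.\<close>

definition cg_in :: "nat \<Rightarrow> 'a::comm_ring_1 mat"
  where "cg_in n = mat (2 * n) (n - 1)
    (\<lambda>(i, c). (if i = n + c then 1 else 0) - (if i = Suc c then 1 else 0))"

definition cg_out :: "nat \<Rightarrow> 'a::comm_ring_1 mat"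
  where "cg_out n = mat (Suc n) (2 * n) (\<lambda>(s, i). if s = i div n + i mod n then 1 else 0)"

definition cg_retract :: "nat \<Rightarrow> 'a::comm_ring_1 mat"
  where "cg_retract n = mat (n - 1) (2 * n) (\<lambda>(c, i). if i = n + c then 1 else 0)"

definition cg_section :: "nat \<Rightarrow> 'a::comm_ring_1 mat"
  where "cg_section n = mat (2 * n) (Suc n)
    (\<lambda>(i, s). if i = (if s < n then s else 2 * n - 1) then 1 else 0)"

lemma cg_carrier:
  "cg_in n \<in> carrier_mat (2 * n) (n - 1)" "cg_out n \<in> carrier_mat (Suc n) (2 * n)"
  "cg_retract n \<in> carrier_mat (n - 1) (2 * n)" "cg_section n \<in> carrier_mat (2 * n) (Suc n)"
  by (simp_all add: cg_in_def cg_out_def cg_retract_def cg_section_def)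

lemmas cg_dim [simp] = cg_carrier[THEN carrier_matD(1)] cg_carrier[THEN carrier_matD(2)]

lemma cg_retract_in: "cg_retract n * cg_in n = (1\<^sub>m (n - 1) :: 'a::comm_ring_1 mat)"
proof (rule eq_matI)
  fix i j assume "i < dim_row (1\<^sub>m (n - 1) :: 'a mat)" "j < dim_col (1\<^sub>m (n - 1) :: 'a mat)"
  then have ij: "i < n - 1" "j < n - 1" by auto
  have "(cg_retract n * cg_in n) $$ (i, j) =
      (\<Sum>k<2 * n. if k = n + i then cg_in n $$ (k, j) else 0 :: 'a)"
    unfolding index_mult[OF cg_carrier(3,1) ij]
    by (rule sum.cong) (use ij in \<open>auto simp: cg_retract_def\<close>)
  also have "\<dots> = cg_in n $$ (n + i, j)" using ij by (simp add: sum.delta)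
  also have "\<dots> = 1\<^sub>m (n - 1) $$ (i, j)" using ij by (simp add: cg_in_def)
  finally show "(cg_retract n * cg_in n) $$ (i, j) = (1\<^sub>m (n - 1) :: 'a mat) $$ (i, j)" .
qed simp_all

lemma cg_out_section:
  assumes "0 < n"
  shows "cg_out n * cg_section n = (1\<^sub>m (Suc n) :: 'a::comm_ring_1 mat)"
proof (rule eq_matI)
  fix i j assume "i < dim_row (1\<^sub>m (Suc n) :: 'a mat)" "j < dim_col (1\<^sub>m (Suc n) :: 'a mat)"
  then have ij: "i < Suc n" "j < Suc n" by auto
  \<comment> \<open>The basis vector chosen over the \<open>j\<close>-th monomial lies in the half
    of \<open>e\<^sub>0\<close>, except for \<open>j = n\<close>, which is reached only from the
    last vector, of index \<open>2 * n - 1\<close>.\<close>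
  define t where "t = (if j < n then j else 2 * n - 1)"
  have t: "t < 2 * n" "t div n + t mod n = j"
    using ij assms div_mod_add_left[of "n - 1" n] by (auto simp: t_def mult_2 less_Suc_eq)
  have "(cg_out n * cg_section n) $$ (i, j) =
      (\<Sum>k<2 * n. if k = t then cg_out n $$ (i, k) else 0 :: 'a)"
    unfolding index_mult[OF cg_carrier(2,4) ij]
    by (rule sum.cong) (use ij in \<open>auto simp: cg_section_def t_def\<close>)
  also have "\<dots> = cg_out n $$ (i, t)" using t by (simp add: sum.delta)
  also have "\<dots> = 1\<^sub>m (Suc n) $$ (i, j)" using ij t by (simp add: cg_out_def)
  finally show "(cg_out n * cg_section n) $$ (i, j) = (1\<^sub>m (Suc n) :: 'a mat) $$ (i, j)" .
qed simp_all

lemma mult_cg_in: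
  assumes "A \<in> carrier_mat m (2 * n)" "i < m" "c < n - 1"
  shows "(A * cg_in n) $$ (i, c) = A $$ (i, n + c) - A $$ (i, Suc c)"
proof -
  have "(A * cg_in n) $$ (i, c) = (\<Sum>k<2 * n.
      (if k = n + c then A $$ (i, k) else 0) - (if k = Suc c then A $$ (i, k) else 0))"
    unfolding index_mult[OF assms(1) cg_carrier(1) assms(2,3)]
    by (rule sum.cong) (use assms in \<open>auto simp: cg_in_def\<close>)
  then show ?thesis using assms by (simp add: sum_subtractf sum.delta)
qed

lemma cg_out_in: "cg_out n * cg_in n = (0\<^sub>m (Suc n) (n - 1) :: 'a::comm_ring_1 mat)"
proof (rule eq_matI)
  fix i j assume "i < dim_row (0\<^sub>m (Suc n) (n - 1) :: 'a mat)"
    "j < dim_col (0\<^sub>m (Suc n) (n - 1) :: 'a mat)"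
  then have ij: "i < Suc n" "j < n - 1" by auto
  then show "(cg_out n * cg_in n) $$ (i, j) = (0\<^sub>m (Suc n) (n - 1) :: 'a mat) $$ (i, j)"
    unfolding mult_cg_in[OF cg_carrier(2) ij] using div_mod_add_left[of j n]
    by (simp add: cg_out_def del: div_add_self1 mod_add_self1)
qed simp_all

text \<open>Basis vectors of index below \<open>n\<close> are fixed by the second product and killed
  by \<open>cg_retract\<close>. A vector of index \<open>n + a\<close> with \<open>a < n - 1\<close>
  is moved to \<open>Suc a\<close>, and column \<open>a\<close> of \<open>cg_in\<close> supplies the
  difference. The last vector is again fixed and killed.\<close>

lemma cg_split:
  assumes "0 < n"
  shows "cg_in n * cg_retract n + cg_section n * cg_out n = (1\<^sub>m (2 * n) :: 'a::comm_ring_1 mat)"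
proof (rule eq_matI)
  fix i j assume "i < dim_row (1\<^sub>m (2 * n) :: 'a mat)" "j < dim_col (1\<^sub>m (2 * n) :: 'a mat)"
  then have ij: "i < 2 * n" "j < 2 * n" by auto
  have in_out: "(cg_in n * cg_retract n) $$ (i, j) =
      (\<Sum>c<n - 1. if j = n + c then cg_in n $$ (i, c) else 0 :: 'a)"
    unfolding index_mult[OF cg_carrier(1,3) ij]
    by (rule sum.cong) (use ij in \<open>auto simp: cg_retract_def\<close>)
  define s where "s = j div n + j mod n"
  have s: "s < Suc n"
    using less_double_cases[OF ij(2)] by cases (auto simp: s_def div_mod_add_left)
  have "(cg_section n * cg_out n) $$ (i, j) =
      (\<Sum>k<Suc n. if k = s then cg_section n $$ (i, k) else 0 :: 'a)"
    unfolding index_mult[OF cg_carrier(4,2) ij]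
    by (rule sum.cong) (use ij in \<open>auto simp: cg_out_def s_def\<close>)
  also have "\<dots> = cg_section n $$ (i, s)" using s by (subst sum.delta) auto
  finally have out_in: "(cg_section n * cg_out n) $$ (i, j) = (cg_section n $$ (i, s) :: 'a)" .
  have sum: "(cg_in n * cg_retract n + cg_section n * cg_out n) $$ (i, j) =
      (cg_in n * cg_retract n) $$ (i, j) + ((cg_section n * cg_out n) $$ (i, j) :: 'a)"
    using ij by (intro index_add_mat) simp_all
  from less_double_cases[OF ij(2)]
  show "(cg_in n * cg_retract n + cg_section n * cg_out n) $$ (i, j) =
      (1\<^sub>m (2 * n) :: 'a mat) $$ (i, j)"
  proof cases
    case 1
    then have "s = j" by (simp add: s_def)
    then show ?thesis unfolding sum in_out out_in using 1 ij by (simp add: cg_section_def)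
  next
    case (2 a)
    have s: "s = Suc a" using 2 by (simp add: s_def div_mod_add_left)
    have "(\<Sum>c<n - 1. if j = n + c then cg_in n $$ (i, c) else 0 :: 'a) =
        (if a < n - 1 then cg_in n $$ (i, a) else 0)"
      using 2 by (simp add: sum.delta)
    then show ?thesis
      unfolding sum in_out out_in s using 2 ij
      by (auto simp: cg_section_def cg_in_def)
  qed
qed simp_all

lemma kron_sym_carrier:
  "kron (sym_mat 1 X) (sym_mat k X) \<in> carrier_mat (2 * Suc k) (2 * Suc k)"
  using kron_carrier[OF sym_mat_carrier sym_mat_carrier, of 1 X k X]
  by (simp only: numeral_2_eq_2 One_nat_def)

lemma kron_sym_index:
  assumes "i < 2 * Suc k" "j < 2 * Suc k"
  shows "kron (sym_mat 1 X) (sym_mat k X) $$ (i, j) =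
    X $$ (i div Suc k, j div Suc k) * coeff (sym_col k X (j mod Suc k)) (i mod Suc k)"
proof -
  note bnd = div_mod_bound[OF assms(1)] div_mod_bound[OF assms(2)]
  have "sym_mat 1 X $$ (i div Suc k, j div Suc k) = X $$ (i div Suc k, j div Suc k)"
    by (intro sym_mat_1 bnd)
  then show ?thesis
    using assms bnd by (simp add: kron_def less_Suc_eq_le)
qed

text \<open>Write \<open>u\<close>, \<open>v\<close> for the columns of \<open>X\<close> as linear
  polynomials. Then \<open>X $$ (r, 1)\<close> times \<open>u\<close> minus
  \<open>X $$ (r, 0)\<close> times \<open>v\<close> is \<open>det X\<close> for \<open>r = 1\<close>
  and \<open>- det X\<close> times the indeterminate for \<open>r = 0\<close>, which is the shape of
  \<open>cg_in\<close>.\<close>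

lemma cg_in_equivariant:
  fixes X :: "'a::field mat"
  assumes X: "X \<in> carrier_mat 2 2"
  shows "cg_in (Suc (Suc l)) * kron (mat 1 1 (\<lambda>_. det X powi 1)) (sym_mat l X) =
    kron (sym_mat 1 X) (sym_mat (Suc l) X) * cg_in (Suc (Suc l))"
    (is "_ * ?D = ?K * _")
proof (rule eq_matI)
  define n where "n = Suc (Suc l)"
  note n = n_def[symmetric]
  have l: "Suc l = n - 1" by (simp add: n_def)
  have D: "?D \<in> carrier_mat (n - 1) (n - 1)" by (simp add: kron_def n_def)
  have K: "?K \<in> carrier_mat (2 * n) (2 * n)" unfolding n_def by (rule kron_sym_carrier)
  fix i c assume "i < dim_row (?K * cg_in (Suc (Suc l)))" "c < dim_col (?K * cg_in (Suc (Suc l)))"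
  then have i: "i < 2 * n" and c: "c < n - 1" using K unfolding n by auto
  have cl: "c \<le> l" using c by (simp add: n_def)
  define f where "f = sym_col l X c"
  have K_index: "?K $$ (i, j) =
      X $$ (i div n, j div n) * coeff (sym_col (Suc l) X (j mod n)) (i mod n)" if "j < 2 * n" for j
    using kron_sym_index[of i "Suc l" j X] i that unfolding n by blast
  have "(?K * cg_in n) $$ (i, c) = X $$ (i div n, 1) * coeff (sym_col (Suc l) X c) (i mod n) -
      X $$ (i div n, 0) * coeff (sym_col (Suc l) X (Suc c)) (i mod n)"
    unfolding mult_cg_in[OF K i c] using c div_mod_add_left[of c n]
    by (simp add: K_index[simplified] del: div_add_self1 mod_add_self1)
  also have "\<dots> = coeff ((smult (X $$ (i div n, 1)) [:X $$ (0, 0), X $$ (1, 0):] -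
      smult (X $$ (i div n, 0)) [:X $$ (0, 1), X $$ (1, 1):]) * f) (i mod n)"
    unfolding sym_col_Suc[OF cl] f_def left_diff_distrib
    by (simp only: mult_smult_left coeff_diff coeff_smult)
  finally have right: "(?K * cg_in n) $$ (i, c) = \<dots>" .
  have "(cg_in n * ?D) $$ (i, c) = (\<Sum>k<n - 1.
      (if i = n + k then det X * coeff f k else 0) - (if i = Suc k then det X * coeff f k else 0))"
    unfolding index_mult[OF cg_carrier(1) D i c]
    by (rule sum.cong) (use i c in \<open>auto simp: cg_in_def kron_def f_def n_def\<close>)
  also have "\<dots> = (\<Sum>k<n - 1. if i = n + k then det X * coeff f k else 0) -
      (\<Sum>k<n - 1. if i = Suc k then det X * coeff f k else 0)"
    by (rule sum_subtractf)
  finally have left: "(cg_in n * ?D) $$ (i, c) = \<dots>" .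
  \<comment> \<open>Coefficients beyond the degree of \<open>f\<close> vanish, so the truncated sums
    are single coefficients at the boundary indices too.\<close>
  have f0: "coeff f k = 0" if "\<not> k < n - 1" for k
    using cl that by (simp add: f_def n_def coeff_sym_col_eq_0)
  from less_double_cases[OF i] have "(cg_in n * ?D) $$ (i, c) = (?K * cg_in n) $$ (i, c)"
  proof cases
    case 1
    have "(\<Sum>k<n - 1. if i = Suc k then det X * coeff f k else 0) =
        (case i of 0 \<Rightarrow> 0 | Suc a \<Rightarrow> det X * coeff f a)"
      using f0 by (cases i) (auto simp: sum.delta)
    moreover have "(\<Sum>k<n - 1. if i = n + k then det X * coeff f k else 0) = 0"
      using 1 by (intro sum.neutral) auto
    ultimately show ?thesis
      unfolding left right using 1
      by (cases i) (auto simp: coeff_pCons det_2[OF X] algebra_simps)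
  next
    case (2 a)
    have "(\<Sum>k<n - 1. if i = Suc k then det X * coeff f k else 0) = 0"
      using 2 by (intro sum.neutral) auto
    moreover have "(\<Sum>k<n - 1. if i = n + k then det X * coeff f k else 0) = det X * coeff f a"
      using 2 f0 by (auto simp: sum.delta)
    ultimately show ?thesis
      unfolding left right using 2
      by (simp add: div_mod_add_left coeff_pCons det_2[OF X] algebra_simps
          del: div_add_self1 mod_add_self1 split: nat.split)
  qed
  then show "(cg_in (Suc (Suc l)) * ?D) $$ (i, c) = (?K * cg_in (Suc (Suc l))) $$ (i, c)"
    unfolding n .
qed (simp_all add: kron_def)

text \<open>The action is a substitution and hence multiplicative: by \<open>sym_col_Suc\<close>,
  the image of \<open>e\<^sub>b\<close> times that of the \<open>a\<close>-th monomial is the image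
  of the monomial with index \<open>b + a\<close>.\<close>

lemma cg_out_equivariant:
  fixes X :: "'a::field mat"
  shows "cg_out (Suc k) * kron (sym_mat 1 X) (sym_mat k X) = sym_mat (Suc k) X * cg_out (Suc k)"
    (is "_ * ?K = ?S * _")
proof (rule eq_matI)
  define n where "n = Suc k"
  note n = n_def[symmetric]
  have S: "?S \<in> carrier_mat (Suc n) (Suc n)" by (simp add: n_def sym_mat_def)
  have K: "?K \<in> carrier_mat (2 * n) (2 * n)" unfolding n_def by (rule kron_sym_carrier)
  fix s j assume "s < dim_row (?S * cg_out (Suc k))" "j < dim_col (?S * cg_out (Suc k))"
  then have s: "s < Suc n" and j: "j < 2 * n" using S unfolding n by auto
  define f where "f = sym_col k X (j mod n)"
  have jm: "j mod n \<le> k" "j div n < 2"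
    using div_mod_bound[OF j] by (auto simp: n_def)
  have t: "j div n + j mod n \<le> n"
    using jm unfolding n_def by linarith
  have f0: "coeff f i = 0" if "\<not> i < n" for i
    using jm that by (simp add: f_def n_def coeff_sym_col_eq_0)
  have K_index: "?K $$ (i, j) = X $$ (i div n, j div n) * coeff f (i mod n)" if "i < 2 * n" for i
    using kron_sym_index[of i k j X] j that unfolding n f_def by blast
  have "(cg_out n * ?K) $$ (s, j) = (\<Sum>i<2 * n. if s = i div n + i mod n
      then X $$ (i div n, j div n) * coeff f (i mod n) else 0)"
    unfolding index_mult[OF cg_carrier(2) K s j]
    by (rule sum.cong) (use s j in \<open>auto simp: cg_out_def K_index[simplified]\<close>)
  also have "\<dots> = (\<Sum>x<2. \<Sum>y<n. if s = x + y then X $$ (x, j div n) * coeff f y else 0)"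
    by (rule sum_div_mod)
  also have "\<dots> = coeff ([:X $$ (0, j div n), X $$ (1, j div n):] * f) s"
    using s f0 by (cases s) (auto simp: numeral_2_eq_2 coeff_pCons sum.delta)
  also have "[:X $$ (0, j div n), X $$ (1, j div n):] * f = sym_col n X (j div n + j mod n)"
    using jm sym_col_Suc[of "j mod n" k X] by (auto simp: f_def n less_2_cases_iff)
  also have "coeff \<dots> s = (\<Sum>i<Suc n. if i = j div n + j mod n then ?S $$ (s, i) else 0)"
    using s t unfolding n by (simp add: sum.delta less_Suc_eq_le del: sum.lessThan_Suc)
  also have "\<dots> = (?S * cg_out n) $$ (s, j)"
    unfolding index_mult[OF S cg_carrier(2) s j]
    by (rule sum.cong) (use j in \<open>auto simp: cg_out_def\<close>)
  finally show "(cg_out (Suc k) * ?K) $$ (s, j) = (?S * cg_out (Suc k)) $$ (s, j)"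
    unfolding n .
qed (simp_all add: kron_def)

text \<open>The product with the zeroth symmetric power would have the zero class on the left;
  \<open>K0_sym_1_mult\<close> treats that case by itself.\<close>

lemma short_exact_Clebsch_Gordan:
  "rep_short_exact (rep_tensor (det_rep 1) (sym_rep l))
    (rep_tensor (sym_rep 1) (sym_rep (Suc l))) (sym_rep (Suc (Suc l)) :: 'a::field rep)"
proof -
  let ?n = "Suc (Suc l)"
  have "split_exact (cg_in ?n :: 'a mat) (cg_out ?n) (cg_retract ?n) (cg_section ?n)
      (?n - 1) (2 * ?n) (Suc ?n)"
    unfolding split_exact_def
    by (intro conjI cg_carrier cg_retract_in cg_out_section cg_out_in cg_split) simp_all
  then have "split_exact (cg_in ?n :: 'a mat) (cg_out ?n) (cg_retract ?n) (cg_section ?n)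
      (rep_dim (rep_tensor (det_rep 1) (sym_rep l) :: 'a rep))
      (rep_dim (rep_tensor (sym_rep 1) (sym_rep (Suc l)) :: 'a rep))
      (rep_dim (sym_rep ?n :: 'a rep))"
    by (simp add: mult_2)
  moreover have "\<forall>X\<in>GL2. (cg_in ?n :: 'a mat) * rep_mat (rep_tensor (det_rep 1) (sym_rep l)) X =
      rep_mat (rep_tensor (sym_rep 1) (sym_rep (Suc l))) X * cg_in ?n"
    unfolding rep_mat_tensor rep_mat_simps using cg_in_equivariant[OF GL2_carrier] by blast
  moreover have "\<forall>X\<in>GL2.
      (cg_out ?n :: 'a mat) * rep_mat (rep_tensor (sym_rep 1) (sym_rep (Suc l))) X =
      rep_mat (sym_rep ?n) X * cg_out ?n"
    unfolding rep_mat_tensor rep_mat_simps using cg_out_equivariant by blast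
  ultimately show ?thesis unfolding rep_short_exact_iff by blast
qed

section \<open>The Frobenius sequence for the symmetric power of degree the characteristic\<close>

text \<open>With \<open>p\<close> the characteristic, \<open>fr_in\<close> maps \<open>e\<^sub>b\<close> to \<open>e\<^sub>b\<^bsup>p\<^esup>\<close>.  In terms of the dehomogenised
  polynomials, \<open>fr_out\<close> is the derivative; its kernel is spanned by the \<open>p\<close>-th powers.\<close>

definition fr_in :: "nat \<Rightarrow> 'a::field mat"
  where "fr_in p = mat (Suc p) 2 (\<lambda>(i, b). if i = p * b then 1 else 0)"

definition fr_out :: "nat \<Rightarrow> 'a::field mat"
  where "fr_out p = mat (p - 1) (Suc p) (\<lambda>(i, j). if j = Suc i then of_nat (Suc i) else 0)"

definition fr_retract :: "nat \<Rightarrow> 'a::field mat"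
  where "fr_retract p = mat 2 (Suc p) (\<lambda>(b, i). if i = p * b then 1 else 0)"

definition fr_section :: "nat \<Rightarrow> 'a::field mat"
  where "fr_section p = mat (Suc p) (p - 1)
    (\<lambda>(i, j). if i = Suc j then inverse (of_nat (Suc j)) else 0)"

lemma fr_carrier:
  "fr_in p \<in> carrier_mat (Suc p) 2" "fr_out p \<in> carrier_mat (p - 1) (Suc p)"
  "fr_retract p \<in> carrier_mat 2 (Suc p)" "fr_section p \<in> carrier_mat (Suc p) (p - 1)"
  by (simp_all add: fr_in_def fr_out_def fr_retract_def fr_section_def)

lemmas fr_dim [simp] = fr_carrier[THEN carrier_matD(1)] fr_carrier[THEN carrier_matD(2)]

lemma mult_fr_in:
  assumes "A \<in> carrier_mat m (Suc p)" "i < m" "b < 2"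
  shows "(A * fr_in p) $$ (i, b) = A $$ (i, p * b)"
proof -
  have "p * b < Suc p" using assms(3) by (auto simp: less_2_cases_iff)
  moreover have "(A * fr_in p) $$ (i, b) = (\<Sum>k<Suc p. if k = p * b then A $$ (i, k) else 0)"
    unfolding index_mult[OF assms(1) fr_carrier(1) assms(2,3)]
    by (rule sum.cong) (use assms(3) in \<open>auto simp: fr_in_def\<close>)
  ultimately show ?thesis by (simp add: sum.delta del: sum.lessThan_Suc)
qed

lemma fr_out_mult:
  assumes "A \<in> carrier_mat (Suc p) m" "i < p - 1" "j < m"
  shows "(fr_out p * A) $$ (i, j) = of_nat (Suc i) * A $$ (Suc i, j)"
proof -
  have "(fr_out p * A) $$ (i, j) =
      (\<Sum>k<Suc p. if k = Suc i then of_nat (Suc i) * A $$ (k, j) else 0)"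
    unfolding index_mult[OF fr_carrier(2) assms]
    by (rule sum.cong) (use assms(2) in \<open>auto simp: fr_out_def\<close>)
  then show ?thesis using assms(2) by (simp add: sum.delta del: sum.lessThan_Suc of_nat_Suc)
qed

lemma fr_retract_in:
  assumes "0 < p"
  shows "fr_retract p * fr_in p = (1\<^sub>m 2 :: 'a::field mat)"
proof (rule eq_matI)
  fix i j assume "i < dim_row (1\<^sub>m 2 :: 'a mat)" "j < dim_col (1\<^sub>m 2 :: 'a mat)"
  then have ij: "i < 2" "j < 2" by auto
  then show "(fr_retract p * fr_in p) $$ (i, j) = (1\<^sub>m 2 :: 'a mat) $$ (i, j)"
    unfolding mult_fr_in[OF fr_carrier(3) ij] using assms
    by (auto simp: fr_retract_def less_2_cases_iff)
qed simp_all

lemma of_nat_less_CHAR: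
  assumes "0 < i" "i < CHAR('a::field)"
  shows "of_nat i \<noteq> (0 :: 'a)"
  using assms by (auto simp: of_nat_eq_0_iff_char_dvd dest: dvd_imp_le)

lemma fr_out_section:
  assumes "p = CHAR('a)"
  shows "fr_out p * fr_section p = (1\<^sub>m (p - 1) :: 'a::field mat)"
proof (rule eq_matI)
  fix i j assume "i < dim_row (1\<^sub>m (p - 1) :: 'a mat)" "j < dim_col (1\<^sub>m (p - 1) :: 'a mat)"
  then have ij: "i < p - 1" "j < p - 1" by auto
  then show "(fr_out p * fr_section p) $$ (i, j) = (1\<^sub>m (p - 1) :: 'a mat) $$ (i, j)"
    unfolding fr_out_mult[OF fr_carrier(4) ij]
    using of_nat_less_CHAR[of "Suc i", where 'a = 'a] assms
    by (auto simp: fr_section_def simp del: of_nat_Suc)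
qed simp_all

lemma fr_out_in: "fr_out p * fr_in p = (0\<^sub>m (p - 1) 2 :: 'a::field mat)"
proof (rule eq_matI)
  fix i j assume "i < dim_row (0\<^sub>m (p - 1) 2 :: 'a mat)" "j < dim_col (0\<^sub>m (p - 1) 2 :: 'a mat)"
  then have ij: "i < p - 1" "j < 2" by auto
  then show "(fr_out p * fr_in p) $$ (i, j) = (0\<^sub>m (p - 1) 2 :: 'a mat) $$ (i, j)"
    unfolding mult_fr_in[OF fr_carrier(2) ij] by (auto simp: fr_out_def less_2_cases_iff)
qed simp_all

text \<open>The first product projects onto the indices \<open>0\<close> and \<open>p\<close>, the
  second onto those strictly between, which are invertible in the field.\<close>

lemma fr_split:
  assumes "p = CHAR('a)" "0 < p"
  shows "fr_in p * fr_retract p + fr_section p * fr_out p = (1\<^sub>m (Suc p) :: 'a::field mat)"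
proof (rule eq_matI)
  fix i j assume "i < dim_row (1\<^sub>m (Suc p) :: 'a mat)" "j < dim_col (1\<^sub>m (Suc p) :: 'a mat)"
  then have ij: "i < Suc p" "j < Suc p" by auto
  have in_out: "(fr_in p * fr_retract p) $$ (i, j) =
      (if i = j \<and> (i = 0 \<or> i = p) then 1 else 0 :: 'a)"
    unfolding index_mult[OF fr_carrier(1,3) ij]
    using ij assms(2) by (auto simp: fr_in_def fr_retract_def numeral_2_eq_2)
  \<comment> \<open>At \<open>j = 0\<close> truncated subtraction makes \<open>j - 1\<close> equal
    to \<open>0\<close>, hence the guard \<open>0 < j\<close>.\<close>
  have "(fr_section p * fr_out p) $$ (i, j) =
      (\<Sum>k<p - 1. if k = j - 1 then (if 0 < j \<and> i = j then 1 else 0) else 0 :: 'a)"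
    unfolding index_mult[OF fr_carrier(4,2) ij]
    by (rule sum.cong)
       (use ij assms of_nat_less_CHAR[where 'a = 'a] in
        \<open>auto simp: fr_section_def fr_out_def simp del: of_nat_Suc\<close>)
  also have "\<dots> = (if i = j \<and> 0 < i \<and> i < p then 1 else 0)"
    using ij by (auto simp: sum.delta)
  finally have out_in: "(fr_section p * fr_out p) $$ (i, j) = \<dots>" .
  have "(fr_in p * fr_retract p + fr_section p * fr_out p) $$ (i, j) =
      (fr_in p * fr_retract p) $$ (i, j) + ((fr_section p * fr_out p) $$ (i, j) :: 'a)"
    using ij by (intro index_add_mat) simp_all
  then show "(fr_in p * fr_retract p + fr_section p * fr_out p) $$ (i, j) =
      (1\<^sub>m (Suc p) :: 'a mat) $$ (i, j)"
    unfolding in_out out_in using ij by (auto simp: less_Suc_eq)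
qed simp_all

lemma linear_poly_power_CHAR:
  fixes a b :: "'a::finite_field"
  shows "[:a, b:] ^ CHAR('a) = [:a ^ CHAR('a):] + monom (b ^ CHAR('a)) CHAR('a)"
proof -
  have "[:a, b:] = [:a:] + monom b 1" by (simp add: monom_Suc monom_0)
  then have "[:a, b:] ^ CHAR('a) = [:a:] ^ CHAR('a) + monom b 1 ^ CHAR('a)"
    by (simp add: freshmans_dream)
  then show ?thesis by (simp add: monom_power poly_const_pow)
qed

text \<open>By the freshman's dream, the \<open>p\<close>-th power of a linear polynomial has at
  most its two extreme coefficients nonzero, and these are the \<open>p\<close>-th powers of the
  original ones.\<close>

lemma fr_in_equivariant:
  fixes X :: "'a::finite_field mat"
  assumes p: "p = CHAR('a)" and X: "X \<in> carrier_mat 2 2"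
  shows "fr_in p * sym_mat 1 (map_mat (frob 1) X) = sym_mat p X * fr_in p"
    (is "_ * ?F = ?S * _")
proof (rule eq_matI)
  have p0: "0 < p" using p CHAR_prime[where 'a = 'a] by (simp add: prime_gt_0_nat)
  have F: "?F \<in> carrier_mat 2 2" using sym_mat_carrier[of 1] by (simp add: numeral_2_eq_2)
  fix i b assume "i < dim_row (?S * fr_in p)" "b < dim_col (?S * fr_in p)"
  then have i: "i < Suc p" and b: "b < 2" by auto
  have F_index: "?F $$ (a, b) = X $$ (a, b) ^ p" if "a < 2" for a
    unfolding sym_mat_1[OF that b] using that b X frob_nat[of 1, where 'a = 'a] by (simp add: p)
  have "(fr_in p * ?F) $$ (i, b) =
      (if i = 0 then X $$ (0, b) ^ p else 0) + (if i = p then X $$ (1, b) ^ p else 0)"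
    unfolding index_mult[OF fr_carrier(1) F i b]
    using i F_index[of 0] F_index[of 1] by (auto simp: fr_in_def numeral_2_eq_2)
  also have "\<dots> = coeff ([:X $$ (0, b), X $$ (1, b):] ^ p) i"
    using p0 unfolding p linear_poly_power_CHAR by (auto simp: coeff_pCons split: nat.split)
  also have "[:X $$ (0, b), X $$ (1, b):] ^ p = sym_col p X (p * b)"
    using b by (auto simp: sym_col_def less_2_cases_iff)
  also have "coeff \<dots> i = (?S * fr_in p) $$ (i, b)"
    unfolding mult_fr_in[OF sym_mat_carrier i b] using i b by (auto simp: less_2_cases_iff)
  finally show "(fr_in p * ?F) $$ (i, b) = (?S * fr_in p) $$ (i, b)" .
qed simp_all

text \<open>In the field \<open>p - j\<close> equals \<open>- j\<close>, so the two terms of the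
  product rule combine into the Wronskian of the two columns of \<open>X\<close>, which is
  \<open>det X\<close>. For \<open>j = 0\<close> and \<open>j = p\<close> the polynomial is a
  \<open>p\<close>-th power and has derivative zero.\<close>

lemma pderiv_sym_col:
  fixes X :: "'a::finite_field mat"
  assumes p: "p = CHAR('a)" and X: "X \<in> carrier_mat 2 2" and j: "j \<le> p"
  shows "pderiv (sym_col p X j) =
    (if 0 < j \<and> j < p then smult (of_nat j * det X) (sym_col (p - 2) X (j - 1)) else 0)"
proof -
  define u v where "u = [:X $$ (0, 0), X $$ (1, 0):]" and "v = [:X $$ (0, 1), X $$ (1, 1):]"
  have p_poly: "of_nat p = (0 :: 'a poly)" using of_nat_CHAR[where 'a = "'a poly"] p by simp
  have p0: "of_nat p = (0 :: 'a)" using p by simp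
  show ?thesis
  proof (cases "0 < j \<and> j < p")
    case True
    then obtain a b where j: "j = Suc b" "p = Suc b + Suc a"
      by (metis add_Suc_right less_imp_Suc_add)
    have neg: "of_nat (Suc a) = - (of_nat (Suc b) :: 'a)"
      using p0 unfolding j(2) of_nat_add eq_neg_iff_add_eq_0 by (simp only: add.commute)
    have "pderiv (u ^ Suc a * v ^ Suc b) =
        smult (of_nat (Suc b)) (u ^ Suc a * v ^ b * pderiv v) +
        smult (of_nat (Suc a)) (u ^ a * v ^ Suc b * pderiv u)"
      by (simp only: pderiv_mult pderiv_power_Suc mult_smult_left mult_smult_right mult_ac)
    also have "\<dots> = smult (of_nat (Suc b)) (u ^ a * v ^ b * (u * pderiv v - v * pderiv u))"
      unfolding neg by (simp add: algebra_simps smult_diff_right del: of_nat_Suc)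
    also have "u * pderiv v - v * pderiv u = [:det X:]"
      by (simp add: u_def v_def pderiv_pCons det_2[OF X] mult.commute)
    finally show ?thesis
      using j True by (simp add: sym_col_def u_def v_def mult_ac)
  next
    case False
    then have "j = 0 \<or> j = p" using j by auto
    then have "\<exists>w. sym_col p X j = w ^ p" by (auto simp: sym_col_def)
    then obtain w where w: "sym_col p X j = w ^ p" by blast
    obtain c where c: "p = Suc c" using p by (metis CHAR_nonzero not0_implies_Suc)
    have "pderiv (w ^ Suc c) = 0"
      unfolding pderiv_power_Suc using p0 by (simp add: c del: of_nat_Suc)
    then have "pderiv (sym_col p X j) = 0" unfolding w unfolding c .
    then show ?thesis using False by (simp only: if_False)
  qed
qed

lemma fr_out_equivariant:
  fixes X :: "'a::finite_field mat"
  assumes p: "p = CHAR('a)" and X: "X \<in> carrier_mat 2 2"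
  shows "fr_out p * sym_mat p X = kron (mat 1 1 (\<lambda>_. det X powi 1)) (sym_mat (p - 2) X) * fr_out p"
    (is "_ * ?S = ?D * _")
proof (rule eq_matI)
  have p2: "2 \<le> p" using p CHAR_prime[where 'a = 'a] by (simp add: prime_ge_2_nat)
  then have p1: "Suc (p - 2) = p - 1" by simp
  have D: "?D \<in> carrier_mat (p - 1) (p - 1)"
    using p1 by (simp add: kron_def)
  fix i j assume "i < dim_row (?D * fr_out p)" "j < dim_col (?D * fr_out p)"
  then have i: "i < p - 1" and j: "j < Suc p" using D by auto
  have "(fr_out p * ?S) $$ (i, j) = coeff (pderiv (sym_col p X j)) i"
    unfolding fr_out_mult[OF sym_mat_carrier i j] using i j
    by (simp add: coeff_pderiv)
  also have "\<dots> =
      (if 0 < j \<and> j < p then of_nat j * det X * coeff (sym_col (p - 2) X (j - 1)) i else 0)"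
    using j by (simp add: pderiv_sym_col[OF p X])
  \<comment> \<open>The range \<open>k < p - 1\<close> now accounts for \<open>j < p\<close>, while
    \<open>0 < j\<close> stays as a guard because \<open>0 - 1 = 0\<close>.\<close>
  also have "\<dots> = (\<Sum>k<p - 1. if k = j - 1 then
      (if 0 < j then of_nat j * det X * coeff (sym_col (p - 2) X (j - 1)) i else 0) else 0)"
    using j by (auto simp: sum.delta)
  also have "\<dots> = (?D * fr_out p) $$ (i, j)"
    unfolding index_mult[OF D fr_carrier(2) i j]
    by (rule sum.cong) (use i j p1 in
        \<open>auto simp: fr_out_def kron_def less_Suc_eq_le simp del: of_nat_Suc\<close>)
  finally show "(fr_out p * ?S) $$ (i, j) = (?D * fr_out p) $$ (i, j)" .
qed (use prime_ge_2_nat[OF CHAR_prime[where 'a = 'a]] in \<open>simp_all add: kron_def p\<close>)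

lemma short_exact_Frobenius:
  assumes p: "p = CHAR('a)"
  shows "rep_short_exact (rep_twist 1 (sym_rep 1)) (sym_rep p)
    (rep_tensor (det_rep 1) (sym_rep (p - 2)) :: 'a::finite_field rep)"
proof -
  have p2: "2 \<le> p" using p CHAR_prime[where 'a = 'a] by (simp add: prime_ge_2_nat)
  have "split_exact (fr_in p :: 'a mat) (fr_out p) (fr_retract p) (fr_section p) 2 (Suc p) (p - 1)"
    unfolding split_exact_def using p p2
    by (intro conjI fr_carrier fr_retract_in fr_out_section fr_out_in fr_split) simp_all
  then have "split_exact (fr_in p :: 'a mat) (fr_out p) (fr_retract p) (fr_section p)
      (rep_dim (rep_twist 1 (sym_rep 1) :: 'a rep)) (rep_dim (sym_rep p :: 'a rep))
      (rep_dim (rep_tensor (det_rep 1) (sym_rep (p - 2)) :: 'a rep))"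
    using p2 by (simp add: numeral_2_eq_2 Suc_diff_Suc)
  moreover have "\<forall>X\<in>GL2. (fr_in p :: 'a mat) * rep_mat (rep_twist 1 (sym_rep 1)) X =
      rep_mat (sym_rep p) X * fr_in p"
    unfolding rep_mat_simps using fr_in_equivariant[OF p GL2_carrier] by blast
  moreover have "\<forall>X\<in>GL2. (fr_out p :: 'a mat) * rep_mat (sym_rep p) X =
      rep_mat (rep_tensor (det_rep 1) (sym_rep (p - 2))) X * fr_out p"
    unfolding rep_mat_tensor rep_mat_simps using fr_out_equivariant[OF p GL2_carrier] by blast
  ultimately show ?thesis unfolding rep_short_exact_iff by blast
qed

section \<open>The identities for all integer indices\<close>

text \<open>Reflection about -1 exchanges the neighbours \<open>k + 1\<close> and
  \<open>k - 1\<close>, and the determinant powers shift accordingly; so indices below -1 inherit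
  the recursion from nonnegative ones. At -1 the two terms on the right cancel.\<close>

lemma K0_sym_1_mult:
  "K0_sym 1 * K0_sym k = (K0_sym (k + 1) + K0_det 1 * K0_sym (k - 1) :: 'a::finite_field K0)"
proof -
  have nonneg: "K0_sym 1 * K0_sym k = (K0_sym (k + 1) + K0_det 1 * K0_sym (k - 1) :: 'a K0)"
    if "0 \<le> k" for k
  proof (cases "k = 0")
    case True
    then show ?thesis by (simp add: K0_sym_0 K0_sym_neg1)
  next
    case False
    with that obtain l where k: "k = int (Suc l)"
      by (metis nonneg_int_cases not0_implies_Suc of_nat_0)
    have l: "k + 1 = int (Suc (Suc l))" "k - 1 = int l" by (simp_all add: k)
    have "K0_class (rep_tensor (sym_rep 1) (sym_rep (Suc l))) =
        K0_class (rep_tensor (det_rep 1) (sym_rep l)) + (K0_class (sym_rep (Suc (Suc l))) :: 'a K0)"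
      by (rule K0_class_exact[OF short_exact_Clebsch_Gordan])
    then show ?thesis
      unfolding l unfolding k K0_sym_nat[of 1, simplified] K0_sym_nat K0_det_def K0_class_tensor
      by (simp add: add.commute)
  qed
  consider "0 \<le> k" | "k = - 1" | "k \<le> - 2" by linarith
  then show ?thesis
  proof cases
    case 2
    have "(K0_sym (- 2) :: 'a K0) = - (K0_det (- 1) * K0_sym 0)" by (subst K0_sym_Delta) simp
    then show ?thesis
      using 2 K0_det_cancel[of 1 "1 :: 'a K0"] by (simp add: K0_sym_0 K0_sym_neg1)
  next
    case 3
    define a where "a = - k - 2"
    have "0 \<le> a" using 3 by (simp add: a_def)
    have idx: "- k - 2 = a" "- (k + 1) - 2 = a - 1" "- (k - 1) - 2 = a + 1"
      "1 + (k + 1) = (1 + k) + 1" "1 + (k - 1) = k"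
      by (simp_all add: a_def)
    have det: "K0_det (1 + k + 1) = K0_det (1 + k) * (K0_det 1 :: 'a K0)"
      "K0_det 1 * (K0_det k * x) = K0_det (1 + k) * x" for x :: "'a K0"
      by (simp_all only: K0_det_add mult.assoc)
    have S: "(K0_sym k :: 'a K0) = - (K0_det (1 + k) * K0_sym a)"
      "(K0_sym (k + 1) :: 'a K0) = - (K0_det (1 + k) * (K0_det 1 * K0_sym (a - 1)))"
      "(K0_det 1 * K0_sym (k - 1) :: 'a K0) = - (K0_det (1 + k) * K0_sym (a + 1))"
      using K0_sym_Delta[of k, where 'a = 'a] K0_sym_Delta[of "k + 1", where 'a = 'a]
        K0_sym_Delta[of "k - 1", where 'a = 'a]
      unfolding idx by (simp_all only: det mult.assoc mult_minus_right)
    have "K0_sym 1 * (K0_sym k :: 'a K0) = - (K0_det (1 + k) * (K0_sym 1 * K0_sym a))"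
      unfolding S(1) by (simp add: mult.left_commute)
    also have "\<dots> = K0_sym (k + 1) + K0_det 1 * K0_sym (k - 1)"
      unfolding nonneg[OF \<open>0 \<le> a\<close>] S(2,3) by (simp add: distrib_left)
    finally show ?thesis .
  qed (rule nonneg)
qed

text \<open>As \<open>e\<close> has the inverse \<open>f\<close>, the recursion runs backwards as
  well as forwards from the two initial zeros.\<close>

lemma linear_recurrence_zero:
  fixes D :: "int \<Rightarrow> 'r::comm_ring_1"
  assumes rec: "\<And>n. D (n + 1) = c * D n - e * D (n - 1)" and inv: "f * e = 1"
    and init: "D a = 0" "D (a + 1) = 0"
  shows "D n = 0"
proof -
  have up: "D (a + int j) = 0 \<and> D (a + int j + 1) = 0" for j
  proof (induction j)
    case (Suc j)
    have eq: "a + int (Suc j) = a + int j + 1" by simp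
    show ?case unfolding eq using rec[of "a + int j + 1"] Suc by simp
  qed (use init in simp)
  have rec_back: "D (n - 1) = f * (c * D n - D (n + 1))" for n
    unfolding rec[of n] using inv by (simp flip: mult.assoc)
  have down: "D (a - int j) = 0 \<and> D (a - int j + 1) = 0" for j
  proof (induction j)
    case (Suc j)
    have eq: "a - int (Suc j) = a - int j - 1" by simp
    show ?case unfolding eq using rec_back[of "a - int j"] Suc by simp
  qed (use init in simp)
  show ?thesis
    using up[of "nat (n - a)"] down[of "nat (a - n)"] by (cases "a \<le> n") auto
qed

lemma K0_sym_Pi:
  "K0_sym n * K0_sym m =
    (K0_sym (n + m) + K0_det 1 * K0_sym (n - 1) * K0_sym (m - 1) :: 'a::finite_field K0)"
proof -
  define D :: "int \<Rightarrow> 'a K0" where "D n = K0_sym n * K0_sym m -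
    (K0_sym (n + m) + K0_det 1 * K0_sym (n - 1) * K0_sym (m - 1))" for n
  have step: "(K0_sym (k + 1) :: 'a K0) = K0_sym 1 * K0_sym k - K0_det 1 * K0_sym (k - 1)" for k
    by (simp add: K0_sym_1_mult)
  have "D n = 0"
  proof (rule linear_recurrence_zero[where D = D and a = "- 1" and f = "K0_det (- 1)"])
    show "D (n + 1) = K0_sym 1 * D n - K0_det 1 * D (n - 1)" for n
    proof -
      have idx: "n + 1 + m = n + m + 1" "n + 1 - 1 = n" "n - 1 + m = n + m - 1"
        by simp_all
      \<comment> \<open>The last product of the defect lags one index behind, so the recursion is
        needed at \<open>n - 1\<close> as well.\<close>
      have n: "(K0_sym n :: 'a K0) = K0_sym 1 * K0_sym (n - 1) - K0_det 1 * K0_sym (n - 1 - 1)"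
        using step[of "n - 1"] by simp
      show ?thesis
        unfolding D_def idx step[of n] step[of "n + m"] n by (simp add: algebra_simps)
    qed
    show "K0_det (- 1) * K0_det 1 = (1 :: 'a K0)"
      using K0_det_add[of "- 1" 1, where 'a = 'a] by (simp add: K0_det_0)
    \<comment> \<open>In the defect at -1 the term \<open>K0_sym (m - 1)\<close> therefore cancels
      against its multiple by \<open>K0_det 1 * K0_sym (- 2)\<close>.\<close>
    have "(K0_sym (- 2) :: 'a K0) = - K0_det (- 1)"
      using K0_sym_Delta[of "- 2", where 'a = 'a] by (simp add: K0_sym_0)
    then show "D (- 1) = 0"
      using K0_det_cancel[of 1 "K0_sym (m - 1) :: 'a K0"]
      by (simp add: D_def K0_sym_neg1 mult.assoc)
    show "D (- 1 + 1) = 0" by (simp add: D_def K0_sym_neg1 K0_sym_0)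
  qed
  then show ?thesis by (simp add: D_def)
qed

lemma K0_sym_Phi:
  assumes p: "p = CHAR('a)"
  shows "K0_sym k = (K0_sym (k - int p) * K0_twist 1 (K0_sym 1) -
    K0_det (int p) * K0_sym (k - 2 * int p) :: 'a::finite_field K0)"
proof -
  define D :: "int \<Rightarrow> 'a K0" where "D k = K0_sym k -
    (K0_sym (k - int p) * K0_twist 1 (K0_sym 1) - K0_det (int p) * K0_sym (k - 2 * int p))" for k
  have p2: "2 \<le> p" using p CHAR_prime[where 'a = 'a] by (simp add: prime_ge_2_nat)
  have step: "(K0_sym (k + 1) :: 'a K0) = K0_sym 1 * K0_sym k - K0_det 1 * K0_sym (k - 1)" for k
    by (simp add: K0_sym_1_mult)
  have "D k = 0"
  proof (rule linear_recurrence_zero[where D = D and a = "int p - 1" and f = "K0_det (- 1)"])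
    show "D (n + 1) = K0_sym 1 * D n - K0_det 1 * D (n - 1)" for n
    proof -
      have idx: "n + 1 - int p = n - int p + 1" "n - 1 - int p = n - int p - 1"
        "n + 1 - 2 * int p = n - 2 * int p + 1" "n - 1 - 2 * int p = n - 2 * int p - 1"
        by simp_all
      show ?thesis
        unfolding D_def idx step by (simp add: algebra_simps)
    qed
    show "K0_det (- 1) * K0_det 1 = (1 :: 'a K0)"
      using K0_det_add[of "- 1" 1, where 'a = 'a] by (simp add: K0_det_0)
    \<comment> \<open>Reflection turns the indices \<open>- p - 1\<close> and \<open>- p\<close>
      into \<open>p - 1\<close> and \<open>p - 2\<close>. The first settles the defect at
      \<open>p - 1\<close>; the second produces the quotient term of the Frobenius sequence, for the
      defect at \<open>p\<close>.\<close>
    have "K0_det (int p) * (K0_sym (- int p - 1) :: 'a K0) = - K0_sym (int p - 1)"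
      using K0_det_cancel[of "int p" "K0_sym (int p - 1) :: 'a K0"]
      by (subst K0_sym_Delta) simp
    then show "D (int p - 1) = 0" by (simp add: D_def K0_sym_neg1)
    have "K0_det (int p) * (K0_sym (- int p) :: 'a K0) = - (K0_det 1 * K0_sym (int p - 2))"
      using K0_det_add[of "int p" "1 - int p", where 'a = 'a]
      by (subst K0_sym_Delta) (simp add: mult.assoc[symmetric])
    moreover have "(K0_class (sym_rep p) :: 'a K0) = K0_class (rep_twist 1 (sym_rep 1)) +
        K0_class (rep_tensor (det_rep 1) (sym_rep (p - 2)))"
      by (rule K0_class_exact[OF short_exact_Frobenius[OF p]])
    then have "K0_sym (int p) = (K0_twist 1 (K0_sym 1) + K0_det 1 * K0_sym (int p - 2) :: 'a K0)"
      using p2 K0_sym_nat[of 1, where 'a = 'a] K0_sym_nat[of "p - 2", where 'a = 'a]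
      by (simp add: K0_sym_nat K0_twist_class K0_class_tensor K0_det_def of_nat_diff)
    ultimately show "D (int p - 1 + 1) = 0" by (simp add: D_def K0_sym_0)
  qed
  then show ?thesis by (simp add: D_def)
qed

section \<open>Reduction to the standard form\<close>

text \<open>Besides the bounds on \<open>p\<close> and \<open>g\<close>, the axioms are rules that a
  computation may use, so results proved here become derivations once the ring is that of
  expressions modulo computation. The equation \<open>M 0 = 1\<close> is not among them.\<close>

locale sym_calculus =
  fixes p g :: nat and E M :: "int \<Rightarrow> 'r::comm_ring_1" and tw :: "int \<Rightarrow> 'r \<Rightarrow> 'r"
  assumes p: "2 \<le> p" and g: "1 \<le> g"
    and E_0: "E 0 = 1" and E_add: "E (m + n) = E m * E n" and E_order: "E (int p ^ g - 1) = 1"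
    and tw_0: "tw 0 x = x" and tw_tw: "tw i (tw j x) = tw (i + j) x"
    and tw_order: "tw (i + int g) x = tw i x"
    and tw_add: "tw i (x + y) = tw i x + tw i y" and tw_mult: "tw i (x * y) = tw i x * tw i y"
    and tw_1: "tw i 1 = 1" and tw_E: "tw (int l) (E m) = E (int p ^ l * m)"
    and Delta: "M k = - (E (1 + k) * M (- k - 2))"
    and Phi: "M k = M (k - int p) * tw 1 (M 1) - E (int p) * M (k - 2 * int p)"
    and Pi: "M n * M m = M (n + m) + E 1 * M (n - 1) * M (m - 1)"
begin

text \<open>\<open>Delta\<close> at -1 shows only that twice this element is zero. \<open>Pi\<close>
  at \<open>0\<close> and \<open>-1\<close> exhibits the element as \<open>M 0\<close> times its own
  double, which finishes the argument.\<close>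

lemma M_neg1: "M (- 1) = 0"
proof -
  define a b where "a = M (- 1)" and "b = M 0"
  have two: "a + a = 0"
    using Delta[of "-1"] by (simp add: a_def E_0 eq_neg_iff_add_eq_0)
  have "M (- 2) = - (E (- 1) * b)" using Delta[of "-2"] by (simp add: b_def)
  moreover have "b * a = a + E 1 * a * M (- 2)"
    using Pi[of 0 "-1"] by (simp add: a_def b_def)
  ultimately have "b * a = a - (E 1 * E (- 1)) * (a * b)" by (simp add: algebra_simps)
  also have "E 1 * E (- 1) = 1" using E_add[of 1 "-1"] E_0 by simp
  finally have "a = (a + a) * b" by (simp add: algebra_simps)
  then show ?thesis by (simp add: two flip: a_def)
qed

lemma M_mult_0: "M m * M 0 = M m"
  using Pi[of m 0] by (simp add: M_neg1)

lemma M_mult_1: "M k * M 1 = M (k + 1) + E 1 * M (k - 1)"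
  using Pi[of k 1] M_mult_0[of "k - 1"] by (simp add: mult.assoc)

lemma tw_0_eq: "tw i 0 = 0"
  using tw_add[of i 0 0] by simp

lemma tw_minus: "tw i (- x) = - tw i x"
  using tw_add[of i x "- x"] by (simp add: tw_0_eq eq_neg_iff_add_eq_0 add.commute)

lemma tw_diff: "tw i (x - y) = tw i x - tw i y"
  using tw_add[of i x "- y"] by (simp add: tw_minus)

text \<open>The periodicity of twists sends a carry out of the last slot back to slot
  \<open>0\<close>.\<close>

lemma tw_Suc_mod:
  assumes "i < g"
  shows "tw (int i) (tw 1 x) = tw (int (Suc i mod g)) x"
proof (cases "Suc i = g")
  case True
  have "tw (int i) (tw 1 x) = tw (0 + int g) x" by (simp add: tw_tw True[symmetric] add.commute)
  then show ?thesis unfolding tw_order using True by simp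
next
  case False
  then show ?thesis using assms by (simp add: tw_tw add.commute)
qed

lemma E_mod: "E m = E (m mod (int p ^ g - 1))"
proof -
  let ?r = "int p ^ g - 1"
  have pos: "E (?r * int n) = 1" for n
    by (induction n) (simp_all add: E_0 E_add E_order ring_distribs)
  have neg: "E (?r * (- int n)) = 1" for n
    using E_add[of "?r * int n" "?r * (- int n)"] by (simp add: E_0 pos)
  have "E (?r * (m div ?r)) = 1"
    by (cases "m div ?r" rule: int_cases2) (use pos neg in auto)
  then show ?thesis
    using E_add[of "?r * (m div ?r)" "m mod ?r"] by simp
qed

section \<open>Rewriting a product in one slot\<close>

definition basic :: "int \<Rightarrow> (nat \<Rightarrow> int) \<Rightarrow> 'r"
  where "basic m k = E m * (\<Prod>i<g. tw (int i) (M (k i)))"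

text \<open>Collecting the other factors in a single \<open>r\<close> independent of
  \<open>x\<close> lets an identity for one \<open>M\<close> act in slot \<open>i\<close>.\<close>

lemma basic_slot:
  assumes "i < g"
  obtains r where "\<And>x. basic m (k(i := x)) = r * tw (int i) (M x)"
    "basic m k = r * tw (int i) (M (k i))"
proof
  let ?r = "E m * (\<Prod>j\<in>{..<g} - {i}. tw (int j) (M (k j)))"
  show upd: "basic m (k(i := x)) = ?r * tw (int i) (M x)" for x
    using assms by (simp add: basic_def prod.remove[of "{..<g}" i] mult_ac)
  show "basic m k = ?r * tw (int i) (M (k i))"
    using upd[of "k i"] by simp
qed

lemma E_basic: "E a * basic m k = basic (a + m) k"
  by (simp add: basic_def E_add mult_ac)

text \<open>Although \<open>M 0\<close> need not be \<open>1\<close>, slot \<open>i\<close> always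
  supplies a factor \<open>M (k i)\<close> on which it acts as a unit.\<close>

lemma basic_mult_0:
  assumes "i < g"
  shows "tw (int i) (M 0) * basic m k = basic m k"
proof -
  obtain r where r: "basic m k = r * tw (int i) (M (k i))"
    using basic_slot[OF assms] by metis
  have "tw (int i) (M 0) * basic m k = r * tw (int i) (M (k i) * M 0)"
    by (simp add: r tw_mult mult_ac)
  then show ?thesis by (simp only: M_mult_0 r)
qed

lemma basic_mult_1:
  assumes "i < g"
  shows "tw (int i) (M 1) * basic m k =
    basic m (k(i := k i + 1)) + basic (int p ^ i + m) (k(i := k i - 1))"
proof -
  obtain r where r: "\<And>x. basic m (k(i := x)) = r * tw (int i) (M x)"
    "basic m k = r * tw (int i) (M (k i))"
    using basic_slot[OF assms] by metis
  have "tw (int i) (M 1) * basic m k = r * tw (int i) (M (k i) * M 1)"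
    by (simp add: r tw_mult mult_ac)
  also have "\<dots> = basic m (k(i := k i + 1)) + E (int p ^ i) * basic m (k(i := k i - 1))"
    unfolding M_mult_1 r tw_mult tw_add tw_E by (simp add: algebra_simps)
  finally show ?thesis by (simp only: E_basic)
qed

lemma basic_Delta:
  assumes "i < g"
  shows "basic m k = - basic (int p ^ i * (1 + k i) + m) (k(i := - k i - 2))"
proof -
  obtain r where r: "\<And>x. basic m (k(i := x)) = r * tw (int i) (M x)"
    "basic m k = r * tw (int i) (M (k i))"
    using basic_slot[OF assms] by metis
  show ?thesis
    unfolding E_basic[symmetric] r by (subst Delta) (simp add: tw_minus tw_mult tw_E mult_ac)
qed

lemma basic_Phi:
  assumes "i < g"
  shows "basic m k = tw (int (Suc i mod g)) (M 1) * basic m (k(i := k i - int p)) -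
    basic (int p ^ i * int p + m) (k(i := k i - 2 * int p))"
proof -
  obtain r where r: "\<And>x. basic m (k(i := x)) = r * tw (int i) (M x)"
    "basic m k = r * tw (int i) (M (k i))"
    using basic_slot[OF assms] by metis
  show ?thesis
    unfolding E_basic[symmetric] r
    by (subst Phi) (simp add: tw_diff tw_mult tw_E tw_Suc_mod[OF assms] algebra_simps)
qed

section \<open>The integer span of the standard products\<close>

text \<open>Requiring zero entries from \<open>g\<close> on represents each tuple by a unique
  function, which makes the set finite and its elements distinct as tuples.\<close>

definition std :: "(int \<times> (nat \<Rightarrow> int)) set"
  where "std = {0..<int p ^ g - 1} \<times>
    {k. \<forall>i. (i \<in> {..<g} \<longrightarrow> k i \<in> {0..int p - 1}) \<and> (i \<notin> {..<g} \<longrightarrow> k i = 0)}"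

lemma finite_std: "finite std"
  unfolding std_def by (intro finite_cartesian_product finite_set_of_finite_funs) auto

definition std_span :: "'r set"
  where "std_span = range (\<lambda>c. \<Sum>t\<in>std. of_int (c t) * basic (fst t) (snd t))"

lemma std_spanE:
  assumes "x \<in> std_span"
  obtains c where "x = (\<Sum>t\<in>std. of_int (c t) * basic (fst t) (snd t))"
  using assms by (auto simp: std_span_def)

lemma std_span_0: "0 \<in> std_span"
  unfolding std_span_def by (rule image_eqI[of _ _ "\<lambda>_. 0"]) auto

lemma std_span_add: "x \<in> std_span \<Longrightarrow> y \<in> std_span \<Longrightarrow> x + y \<in> std_span"
proof (elim std_spanE)
  fix c d
  assume "x = (\<Sum>t\<in>std. of_int (c t) * basic (fst t) (snd t))"
    "y = (\<Sum>t\<in>std. of_int (d t) * basic (fst t) (snd t))"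
  then show "x + y \<in> std_span"
    unfolding std_span_def
    by (intro image_eqI[of _ _ "\<lambda>t. c t + d t"]) (simp_all add: distrib_right sum.distrib)
qed

lemma std_span_minus: "x \<in> std_span \<Longrightarrow> - x \<in> std_span"
proof (elim std_spanE)
  fix c
  assume "x = (\<Sum>t\<in>std. of_int (c t) * basic (fst t) (snd t))"
  then show "- x \<in> std_span"
    unfolding std_span_def
    by (intro image_eqI[of _ _ "\<lambda>t. - c t"]) (simp_all add: sum_negf)
qed

lemma std_span_diff: "x \<in> std_span \<Longrightarrow> y \<in> std_span \<Longrightarrow> x - y \<in> std_span"
  using std_span_add[OF _ std_span_minus] by fastforce

lemma basic_in_std_span_reduced:
  assumes "\<And>i. i < g \<Longrightarrow> 0 \<le> k i \<and> k i \<le> int p - 1"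
  shows "basic m k \<in> std_span"
proof -
  define t where "t = (m mod (int p ^ g - 1), \<lambda>i. if i < g then k i else 0)"
  \<comment> \<open>This makes \<open>int p ^ g - 1\<close> positive, so the remainder of
    \<open>m\<close> lies in the required range.\<close>
  have "(2::int) ^ 1 \<le> 2 ^ g" by (rule power_increasing) (use g in auto)
  also have "\<dots> \<le> int p ^ g" by (rule power_mono) (use p in auto)
  finally have t: "t \<in> std" using assms by (auto simp: t_def std_def)
  have "basic m k = basic (fst t) (snd t)"
    unfolding basic_def t_def using E_mod[of m] by simp
  also have "\<dots> = (\<Sum>s\<in>std. if s = t then basic (fst s) (snd s) else 0)"
    using t finite_std by simp
  also have "\<dots> = (\<Sum>s\<in>std. of_int (if s = t then 1 else 0) * basic (fst s) (snd s))"
    by (rule sum.cong) auto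
  finally show ?thesis
    unfolding std_span_def by (rule image_eqI[where x = "\<lambda>s. if s = t then 1 else 0"]) simp
qed

section \<open>Termination of the reduction\<close>

text \<open>The weight drops under the normalisation steps: a carry into the next slot costs at most 3,
  but subtracting \<open>p\<close> in the present slot gains at least 4.\<close>

definition weight :: "int \<Rightarrow> nat"
  where "weight k = nat (if k < - 1 then - 2 * k - 1 else 2 * k + 2)"

definition total_weight :: "(nat \<Rightarrow> int) \<Rightarrow> nat"
  where "total_weight k = (\<Sum>i<g. weight (k i))"

lemma total_weight_upd:
  assumes "i < g"
  shows "total_weight (k(i := x)) + weight (k i) = total_weight k + weight x"
  using assms by (simp add: total_weight_def sum.remove[of "{..<g}" i])

lemma basic_in_std_span: "basic m k \<in> std_span"
proof (induction "total_weight k" arbitrary: m k rule: less_induct)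
  case less
  consider i where "i < g" "k i = - 1" | i where "i < g" "k i < - 1"
    | i where "i < g" "int p \<le> k i" | "\<And>i. i < g \<Longrightarrow> 0 \<le> k i \<and> k i \<le> int p - 1"
    by (metis linorder_not_less zle_diff1_eq linorder_neqE_linordered_idom
        add1_zle_eq neg_eq_iff_add_eq_0 add.commute)
  then show ?case
  proof cases
    case 1
    then have "(\<Prod>i<g. tw (int i) (M (k i))) = 0"
      by (intro prod_zero) (auto simp: M_neg1 tw_0_eq intro!: bexI[of _ i])
    then show ?thesis by (simp add: basic_def std_span_0)
  next
    case 2
    \<comment> \<open>Reflection of an index below -1 lowers its weight by exactly one.\<close>
    have "total_weight (k(i := - k i - 2)) < total_weight k"
      using total_weight_upd[OF 2(1), of k "- k i - 2"] 2(2) by (simp add: weight_def)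
    from less[OF this] show ?thesis
      by (subst basic_Delta[OF 2(1)]) (rule std_span_minus)
  next
    case 3
    \<comment> \<open>The subtraction of \<open>p\<close> is accounted for before the carry, because
      for \<open>g = 1\<close> the next slot is slot \<open>i\<close> itself.\<close>
    define k' where "k' = k(i := k i - int p)"
    define j where "j = Suc i mod g"
    have j: "j < g" using g by (simp add: j_def)
    have k': "total_weight k' + 4 \<le> total_weight k"
      using total_weight_upd[OF 3(1), of k "k i - int p"] 3(2) p by (simp add: k'_def weight_def)
    have "total_weight (k'(j := k' j + 1)) < total_weight k"
      "total_weight (k'(j := k' j - 1)) < total_weight k"
      using total_weight_upd[OF j, of k' "k' j + 1"] total_weight_upd[OF j, of k' "k' j - 1"] k'
      by (simp_all add: weight_def split: if_splits)
    then have "tw (int j) (M 1) * basic m k' \<in> std_span"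
      unfolding basic_mult_1[OF j] by (intro std_span_add less)
    \<comment> \<open>If the new index is below -1, its weight is
      \<open>4 * p - 2 * k i - 1\<close>, still less than \<open>2 * k i + 2\<close> because
      \<open>p\<close> is at most \<open>k i\<close>.\<close>
    moreover have "total_weight (k(i := k i - 2 * int p)) < total_weight k"
      using total_weight_upd[OF 3(1), of k "k i - 2 * int p"] 3(2) p
      by (simp add: weight_def split: if_splits)
    then have "basic (int p ^ i * int p + m) (k(i := k i - 2 * int p)) \<in> std_span" by (rule less)
    ultimately show ?thesis
      by (subst basic_Phi[OF 3(1)]) (auto simp: k'_def j_def intro: std_span_diff)
  qed (rule basic_in_std_span_reduced)
qed

section \<open>Closure of the span under products\<close>

text \<open>Products are reduced one factor at a time: these multipliers are closed under products
  and differences, so only determinant powers and twists of \<open>M 1\<close> and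
  \<open>M 0\<close> have to be examined directly.\<close>

definition stabilizer :: "'r set"
  where "stabilizer = {r. \<forall>x\<in>std_span. r * x \<in> std_span}"

text \<open>The span consists of integer combinations, so a multiplier can be tested on single
  products. The indices are arbitrary because the results of multiplication need only lie in the
  span.\<close>

lemma stabilizerI:
  assumes "\<And>m k. r * basic m k \<in> std_span"
  shows "r \<in> stabilizer"
  unfolding stabilizer_def
proof safe
  have int: "of_int c * x \<in> std_span" if x: "x \<in> std_span" for c :: int and x
  proof -
    have "of_nat n * x \<in> std_span" for n
      by (induction n) (auto simp: std_span_0 distrib_right intro: std_span_add x)
    then show ?thesis
      by (cases c rule: int_cases2) (auto intro: std_span_minus)
  qed
  have sum: "sum f T \<in> std_span" if "\<And>t. f t \<in> std_span"
    for f :: "int \<times> (nat \<Rightarrow> int) \<Rightarrow> 'r" and T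
    by (induction T rule: infinite_finite_induct) (auto simp: std_span_0 intro: std_span_add that)
  fix x assume "x \<in> std_span"
  then obtain c where x: "x = (\<Sum>t\<in>std. of_int (c t) * basic (fst t) (snd t))"
    by (rule std_spanE)
  have "r * x = (\<Sum>t\<in>std. of_int (c t) * (r * basic (fst t) (snd t)))"
    by (simp add: x sum_distrib_left mult_ac)
  also have "\<dots> \<in> std_span" by (intro sum int assms)
  finally show "r * x \<in> std_span" .
qed

lemma stabilizer_mult: "r \<in> stabilizer \<Longrightarrow> s \<in> stabilizer \<Longrightarrow> r * s \<in> stabilizer"
  by (auto simp: stabilizer_def mult.assoc)

lemma stabilizer_diff: "r \<in> stabilizer \<Longrightarrow> s \<in> stabilizer \<Longrightarrow> r - s \<in> stabilizer"
  by (auto simp: stabilizer_def left_diff_distrib intro: std_span_diff)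

lemma stabilizer_minus: "r \<in> stabilizer \<Longrightarrow> - r \<in> stabilizer"
  by (auto simp: stabilizer_def intro: std_span_minus)

lemma E_in_stabilizer: "E a \<in> stabilizer"
  by (rule stabilizerI) (simp add: E_basic basic_in_std_span)

text \<open>Multiplication by \<open>M 0\<close> and \<open>M 1\<close> preserves the span directly.
  The recursion expresses higher nonnegative indices through these, and \<open>Delta\<close> reduces
  negative indices to nonnegative ones.\<close>

lemma tw_M_in_stabilizer:
  assumes i: "i < g"
  shows "tw (int i) (M n) \<in> stabilizer"
proof -
  have one: "tw (int i) (M 1) \<in> stabilizer"
    by (rule stabilizerI)
       (simp add: basic_mult_1[OF i] std_span_add basic_in_std_span)
  have nat: "tw (int i) (M (int n)) \<in> stabilizer" for n
  proof (induction n rule: less_induct)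
    case (less n)
    show ?case
    proof (cases "n \<le> 1")
      case True
      then consider "n = 0" | "n = 1" by linarith
      then show ?thesis
        by cases (auto simp: one basic_mult_0[OF i] basic_in_std_span intro: stabilizerI)
    next
      case False
      have "M (int n) = M (int (n - 1)) * M 1 - E 1 * M (int (n - 2))"
        using M_mult_1[of "int n - 1"] False by (simp add: of_nat_diff)
      then have eq: "tw (int i) (M (int n)) =
          tw (int i) (M (int (n - 1))) * tw (int i) (M 1) -
          E (int p ^ i) * tw (int i) (M (int (n - 2)))"
        using tw_E[of i 1] by (simp add: tw_diff tw_mult)
      show ?thesis
        unfolding eq using False
        by (intro stabilizer_diff stabilizer_mult less one E_in_stabilizer) auto
    qed
  qed
  consider "n \<ge> 0" | "n = - 1" | "n \<le> - 2" by linarith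
  then show ?thesis
  proof cases
    case 1
    then show ?thesis using nat[of "nat n"] by simp
  next
    case 2
    then show ?thesis by (simp add: M_neg1 tw_0_eq stabilizer_def std_span_0)
  next
    case 3
    then have eq: "M n = - (E (1 + n) * M (int (nat (- n - 2))))" using Delta[of n] by simp
    show ?thesis
      unfolding eq
      by (simp only: tw_minus tw_mult tw_E stabilizer_minus stabilizer_mult E_in_stabilizer nat)
  qed
qed

lemma basic_in_stabilizer: "basic m k \<in> stabilizer"
proof -
  have "1 \<in> stabilizer" by (simp add: stabilizer_def)
  then have "(\<Prod>i\<in>I. tw (int i) (M (k i))) \<in> stabilizer" if "I \<subseteq> {..<g}" for I
    using that
    by (induction I rule: infinite_finite_induct) (auto intro: stabilizer_mult tw_M_in_stabilizer)
  then show ?thesis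
    unfolding basic_def by (intro stabilizer_mult E_in_stabilizer) auto
qed

end

section \<open>The ring of expressions modulo computation\<close>

text \<open>Equality in the Grothendieck ring is built into the relation, so that its quotient is not
  the zero ring.  The exponent \<open>g\<close> has to be a
  function of the type; it is the intended one when the number of elements of the field is a
  power of the characteristic.\<close>

definition field_exponent :: "'a::finite_field itself \<Rightarrow> nat"
  where "field_exponent _ = (LEAST g. CARD('a) = CHAR('a) ^ g)"

definition calc_eq :: "'a::finite_field itself \<Rightarrow> vexpr \<Rightarrow> vexpr \<Rightarrow> bool"
  where "calc_eq F x y \<longleftrightarrow>
    computes CHAR('a) (field_exponent F) (Delta \<union> Phi CHAR('a) \<union> Pi_rel) x y \<and>
    (K0_val x :: 'a K0) = K0_val y"

quotient_type (overloaded) 'a calc = vexpr / "calc_eq TYPE('a::finite_field)"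
proof (intro equivpI reflpI sympI transpI)
  fix x y z
  show "calc_eq TYPE('a) x x" by (simp add: calc_eq_def computes.refl)
  show "calc_eq TYPE('a) y x" if "calc_eq TYPE('a) x y"
    using that by (simp add: calc_eq_def computes.sym)
  show "calc_eq TYPE('a) x z" if "calc_eq TYPE('a) x y" "calc_eq TYPE('a) y z"
    using that by (auto simp: calc_eq_def intro: computes.trans)
qed

instantiation calc :: (finite_field) comm_ring_1
begin

lift_definition zero_calc :: "'a calc" is "Cst 0" .

lift_definition one_calc :: "'a calc" is "Cst 1" .

lift_definition plus_calc :: "'a calc \<Rightarrow> 'a calc \<Rightarrow> 'a calc" is Add
  by (simp add: calc_eq_def computes.cong_add)

lift_definition uminus_calc :: "'a calc \<Rightarrow> 'a calc" is Neg
  by (simp add: calc_eq_def computes.cong_neg)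

lift_definition minus_calc :: "'a calc \<Rightarrow> 'a calc \<Rightarrow> 'a calc" is "\<lambda>x y. x \<^bold>+ Neg y"
  by (simp add: calc_eq_def computes.cong_add computes.cong_neg)

lift_definition times_calc :: "'a calc \<Rightarrow> 'a calc \<Rightarrow> 'a calc" is Mul
  by (simp add: calc_eq_def computes.cong_mul)

instance
proof
  fix a b c :: "'a calc"
  show "a + b + c = a + (b + c)"
    by transfer (simp add: calc_eq_def computes.add_assoc add.assoc)
  show "a + b = b + a"
    by transfer (simp add: calc_eq_def computes.add_commute add.commute)
  show "0 + a = a"
    by transfer (simp add: calc_eq_def computes.add_zero)
  show "- a + a = 0"
    by transfer (simp add: calc_eq_def computes.add_neg)
  show "a - b = a + - b"
    by transfer (simp add: calc_eq_def computes.refl)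
  show "a * b * c = a * (b * c)"
    by transfer (simp add: calc_eq_def computes.mul_assoc mult.assoc)
  show "a * b = b * a"
    by transfer (simp add: calc_eq_def computes.mul_commute mult.commute)
  show "1 * a = a"
    by transfer (simp add: calc_eq_def computes.mul_one)
  show "(a + b) * c = a * c + b * c"
    by transfer (simp add: calc_eq_def computes.distrib distrib_right)
  show "(0 :: 'a calc) \<noteq> 1"
    by transfer (simp add: calc_eq_def)
qed

end

lift_definition calc_det :: "int \<Rightarrow> 'a::finite_field calc" is Det .

lift_definition calc_sym :: "int \<Rightarrow> 'a::finite_field calc" is Sym .

lift_definition calc_twist :: "int \<Rightarrow> 'a::finite_field calc \<Rightarrow> 'a calc" is Twist
  by (simp add: calc_eq_def computes.cong_twist)

lemma abs_calc_add: "abs_calc (x \<^bold>+ y) = abs_calc x + abs_calc y"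
  by transfer (simp add: calc_eq_def computes.refl)

lemma abs_calc_mul: "abs_calc (x \<^bold>* y) = abs_calc x * abs_calc y"
  by transfer (simp add: calc_eq_def computes.refl)

lemma abs_calc_neg: "abs_calc (Neg x) = - abs_calc x"
  by transfer (simp add: calc_eq_def computes.refl)

lemma abs_calc_cst: "abs_calc (Cst c) = (of_int c :: 'a::finite_field calc)"
proof -
  have zero: "abs_calc (Cst 0) = (0 :: 'a calc)" and one: "abs_calc (Cst 1) = (1 :: 'a calc)"
    by (simp_all add: zero_calc_def one_calc_def)
  have add: "abs_calc (Cst (a + b)) = (abs_calc (Cst a) + abs_calc (Cst b) :: 'a calc)" for a b
    by transfer (simp add: calc_eq_def computes.cst_add)
  have nat: "abs_calc (Cst (int n)) = (of_nat n :: 'a calc)" for n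
    by (induction n) (simp_all add: zero one add)
  have "abs_calc (Cst (- int n)) = (- of_nat n :: 'a calc)" for n
    using add[of "- int n" "int n"] by (simp add: zero nat eq_neg_iff_add_eq_0)
  with nat show ?thesis by (cases c rule: int_cases2) simp_all
qed

lemma abs_calc_basic_expr:
  "abs_calc (basic_expr m k h) = calc_det m * (\<Prod>i<h. calc_twist (int i) (calc_sym (k i)))"
proof (induction h)
  case 0
  then show ?case by (simp add: calc_det.abs_eq)
next
  case (Suc h)
  have "abs_calc (Twist (int h) (Sym (k h))) = (calc_twist (int h) (calc_sym (k h)) :: 'a calc)"
    by (simp add: calc_sym.abs_eq calc_twist.abs_eq)
  with Suc show ?case by (simp add: abs_calc_mul mult.assoc)
qed

text \<open>Soundness of the three families, which the second half of \<open>calc_eq\<close>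
  demands.\<close>

lemma K0_identities:
  assumes "(l, r) \<in> Delta \<union> Phi CHAR('a) \<union> Pi_rel"
  shows "(K0_val l :: 'a::finite_field K0) = K0_val r"
proof -
  from assms consider "(l, r) \<in> Delta" | "(l, r) \<in> Phi CHAR('a)" | "(l, r) \<in> Pi_rel" by blast
  then show ?thesis
  proof cases
    case 1
    then obtain k where "l = Sym k" "r = Neg (Det (1 + k) \<^bold>* Sym (- k - 2))"
      by (auto simp: Delta_def)
    then show ?thesis using K0_sym_Delta[of k, where 'a = 'a] by simp
  next
    case 2
    then obtain k where "l = Sym k" "r = Sym (k - int CHAR('a)) \<^bold>* Twist 1 (Sym 1) \<^bold>+
        Neg (Det (int CHAR('a)) \<^bold>* Sym (k - 2 * int CHAR('a)))"
      by (auto simp: Phi_def)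
    then show ?thesis using K0_sym_Phi[OF HOL.refl, of k, where 'a = 'a] by simp
  next
    case 3
    then obtain n m where "l = Sym n \<^bold>* Sym m"
        "r = Sym (n + m) \<^bold>+ Det 1 \<^bold>* Sym (n - 1) \<^bold>* Sym (m - 1)"
      by (auto simp: Pi_rel_def)
    then show ?thesis using K0_sym_Pi[of n m, where 'a = 'a] by simp
  qed
qed

lemma calc_identity:
  assumes "(l, r) \<in> Delta \<union> Phi CHAR('a) \<union> Pi_rel"
  shows "calc_eq TYPE('a::finite_field) l r"
  unfolding calc_eq_def using assms K0_identities by (intro conjI computes.identity)

text \<open>Each axiom is obtained from a rule of \<open>computes\<close> together with its validity
  in the Grothendieck ring, since \<open>calc_eq\<close> asks for both.\<close>

lemma sym_calculus_calc:
  assumes card: "CARD('a::finite_field) = CHAR('a) ^ field_exponent TYPE('a)"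
  shows "sym_calculus CHAR('a) (field_exponent TYPE('a)) calc_det calc_sym
    (calc_twist :: int \<Rightarrow> 'a calc \<Rightarrow> 'a calc)"
proof
  show "2 \<le> CHAR('a)" using CHAR_prime[where 'a = 'a] by (rule prime_ge_2_nat)
  have "card {0, 1 :: 'a} \<le> CARD('a)" by (rule card_mono) auto
  then show "1 \<le> field_exponent TYPE('a)" using card by (cases "field_exponent TYPE('a)") auto
  fix m n :: int and x y :: "'a calc" and l :: nat
  show "calc_det 0 = (1 :: 'a calc)"
    by transfer (simp add: calc_eq_def computes.det_zero K0_det_0)
  show "calc_det (m + n) = (calc_det m * calc_det n :: 'a calc)"
    by transfer (simp add: calc_eq_def computes.det_add K0_det_add)
  show "calc_det (int CHAR('a) ^ field_exponent TYPE('a) - 1) = (1 :: 'a calc)"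
    using K0_det_order[where 'a = 'a] unfolding card
    by transfer (simp add: calc_eq_def computes.det_order)
  show "calc_twist 0 x = x"
    by transfer (simp add: calc_eq_def computes.twist_zero K0_twist_0)
  show "calc_twist m (calc_twist n x) = calc_twist (m + n) x"
    by transfer (simp add: calc_eq_def computes.twist_twist K0_twist_twist)
  show "calc_twist (n + int (field_exponent TYPE('a))) x = calc_twist n x"
    by transfer
       (simp add: calc_eq_def computes.twist_order K0_twist_cong[OF frob_order[OF card]])
  show "calc_twist n (x + y) = calc_twist n x + calc_twist n y"
    by transfer (simp add: calc_eq_def computes.twist_add K0_twist_add)
  show "calc_twist n (x * y) = calc_twist n x * calc_twist n y"
    by transfer (simp add: calc_eq_def computes.twist_mul K0_twist_mult)
  show "calc_twist n 1 = (1 :: 'a calc)"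
    by transfer (simp add: calc_eq_def computes.twist_one K0_twist_1)
  show "calc_twist (int l) (calc_det m) = (calc_det (int CHAR('a) ^ l * m) :: 'a calc)"
    by transfer (simp add: calc_eq_def computes.twist_det K0_twist_det)
  show "calc_sym n = - (calc_det (1 + n) * calc_sym (- n - 2) :: 'a calc)"
    by transfer (rule calc_identity, auto simp: Delta_def)
  show "calc_sym n = (calc_sym (n - int CHAR('a)) * calc_twist 1 (calc_sym 1) -
      calc_det (int CHAR('a)) * calc_sym (n - 2 * int CHAR('a)) :: 'a calc)"
    by transfer (rule calc_identity, auto simp: Phi_def)
  show "calc_sym n * calc_sym m =
      (calc_sym (n + m) + calc_det 1 * calc_sym (n - 1) * calc_sym (m - 1) :: 'a calc)"
    by transfer (rule calc_identity, auto simp: Pi_rel_def)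
qed

section \<open>From the quotient ring back to explicit standard forms\<close>

lemma K0_val_combination:
  "K0_val (combination g n m k N) =
    (\<Sum>j<N. of_int (n j) * (K0_det (m j) * (\<Prod>i<g. K0_twist (int i) (K0_sym (k j i)))))"
proof -
  have "K0_val (basic_expr m k h) = (K0_det m * (\<Prod>i<h. K0_twist (int i) (K0_sym (k i))) :: 'a K0)"
    for m k h
    by (induction h) (simp_all add: mult.assoc)
  then show ?thesis by (induction N) simp_all
qed

lemma abs_calc_combination:
  "abs_calc (combination g n m k N) = (\<Sum>j<N. of_int (n j) * abs_calc (basic_expr (m j) (k j) g))"
  by (induction N) (simp_all add: abs_calc_add abs_calc_mul abs_calc_cst)

lemma JH_computable_calc:
  assumes card: "CARD('a::finite_field) = CHAR('a) ^ field_exponent TYPE('a)"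
    and x: "algebraic_sum (field_exponent TYPE('a)) x"
  shows "JH_computable TYPE('a) CHAR('a) (field_exponent TYPE('a))
    (Delta \<union> Phi CHAR('a) \<union> Pi_rel) x"
proof -
  define g where "g = field_exponent TYPE('a)"
  interpret sym_calculus "CHAR('a)" g calc_det calc_sym "calc_twist :: int \<Rightarrow> 'a calc \<Rightarrow> 'a calc"
    unfolding g_def by (rule sym_calculus_calc[OF card])
  have basic_expr: "abs_calc (basic_expr m k g) = basic m k" for m k
    by (simp add: abs_calc_basic_expr basic_def)
  \<comment> \<open>Both memberships are carried along: the left factor of a product acts as a
    multiplier on the right one.\<close>
  have product: "abs_calc y \<in> stabilizer \<and> abs_calc y \<in> std_span" if "product_expr g y" for y
    using that
  proof induction
    case (1 m k)
    then show ?case by (simp add: basic_expr basic_in_stabilizer basic_in_std_span)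
  next
    case (2 y z)
    then show ?case
      by (simp add: abs_calc_mul stabilizer_mult) (simp add: stabilizer_def)
  qed
  have "abs_calc x \<in> std_span"
    using x unfolding g_def[symmetric]
  proof induction
    case 1
    then show ?case by (simp add: abs_calc_cst std_span_0)
  qed (simp_all add: product abs_calc_neg abs_calc_add std_span_minus std_span_add)
  then obtain c where c: "abs_calc x = (\<Sum>t\<in>std. of_int (c t) * basic (fst t) (snd t))"
    by (rule std_spanE)
  \<comment> \<open>Standard forms have nonzero coefficients only; the remaining finite set is
    enumerated to match the index set \<open>{..<N}\<close>.\<close>
  define T where "T = {t \<in> std. c t \<noteq> 0}"
  have "finite T" using finite_std by (simp add: T_def)
  then obtain h where h: "bij_betw h {0..<card T} T"
    using ex_bij_betw_nat_finite by blast
  define N n m k where "N = card T" and "n = c \<circ> h" and "m = fst \<circ> h" and "k = snd \<circ> h"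
  note defs = N_def n_def m_def k_def
  have h_T: "h j \<in> T" if "j < N" for j
    using h that by (auto simp: bij_betw_def N_def)
  have "abs_calc x = (\<Sum>t\<in>T. of_int (c t) * basic (fst t) (snd t))"
    unfolding c by (rule sum.mono_neutral_right) (auto simp: T_def finite_std)
  also have "\<dots> = (\<Sum>j<N. of_int (n j) * basic (m j) (k j))"
    using sum.reindex_bij_betw[OF h, symmetric] by (simp add: defs lessThan_atLeast0)
  also have "\<dots> = abs_calc (combination g n m k N)"
    by (simp add: abs_calc_combination basic_expr)
  finally have eq: "calc_eq TYPE('a) x (combination g n m k N)"
    by (simp add: calc.abs_eq_iff)
  have distinct: "m j \<noteq> m j' \<or> (\<exists>i<g. k j i \<noteq> k j' i)" if "j < N" "j' < N" "j \<noteq> j'" for j j'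
  proof (rule ccontr)
    assume "\<not> ?thesis"
    then have "m j = m j'" "\<And>i. i < g \<Longrightarrow> k j i = k j' i" by auto
    \<comment> \<open>Elements of \<open>std\<close> vanish from \<open>g\<close> on, so agreement
      below \<open>g\<close> makes the functions equal and contradicts injectivity of
      \<open>h\<close>.\<close>
    moreover have "k j i = k j' i" if "\<not> i < g" for i
      using h_T[OF \<open>j < N\<close>] h_T[OF \<open>j' < N\<close>] that by (auto simp: defs T_def std_def)
    ultimately have "h j = h j'" by (auto simp: defs prod_eq_iff)
    then show False
      using h that by (auto simp: bij_betw_def N_def inj_on_def)
  qed
  have range: "n j \<noteq> 0 \<and> 0 \<le> m j \<and> m j < int CHAR('a) ^ g - 1 \<and>
      (\<forall>i<g. 0 \<le> k j i \<and> k j i \<le> int CHAR('a) - 1)" if "j < N" for j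
    using h_T[OF that] by (auto simp: defs T_def std_def)
  show ?thesis
    unfolding JH_computable_def g_def[symmetric]
  proof (intro exI conjI)
    show "computes CHAR('a) g (Delta \<union> Phi CHAR('a) \<union> Pi_rel) x (combination g n m k N)"
      using eq by (simp add: calc_eq_def g_def)
    show "(K0_val x :: 'a K0) =
        (\<Sum>j<N. of_int (n j) * (K0_det (m j) * (\<Prod>i<g. K0_twist (int i) (K0_sym (k j i)))))"
      using eq by (simp add: calc_eq_def K0_val_combination)
  qed (use range distinct in blast)+
qed

text \<open>Translation by \<open>1\<close> permutes the field, so the sum of all elements does not
  change although \<open>CARD('a)\<close> times \<open>1\<close> is added.\<close>

lemma CHAR_dvd_CARD: "CHAR('a::finite_field) dvd CARD('a)"
proof -
  have "(\<Sum>x\<in>UNIV. x) = (\<Sum>x\<in>UNIV. x + (1 :: 'a))"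
    by (rule sum.reindex_bij_witness[of _ "\<lambda>x. x + 1" "\<lambda>x. x - 1"]) auto
  then have "of_nat CARD('a) = (0 :: 'a)" by (simp add: sum.distrib)
  then show ?thesis by (simp add: of_nat_eq_0_iff_char_dvd)
qed

theorem theorem3p7:
  fixes p g :: nat
  assumes "prime p" and "g \<ge> 1" and "CARD('a::finite_field) = p ^ g"
  shows "(\<forall>(l, r) \<in> Delta \<union> Phi p \<union> Pi_rel. (K0_val l :: 'a K0) = K0_val r) \<and>
    (\<forall>x. algebraic_sum g x \<longrightarrow> JH_computable TYPE('a) p g (Delta \<union> Phi p \<union> Pi_rel) x)"
proof -
  \<comment> \<open>A prime dividing a power of the prime \<open>p\<close> is \<open>p\<close>,
    which identifies the characteristic.\<close>
  have "CHAR('a) dvd p ^ g" using CHAR_dvd_CARD[where 'a = 'a] assms(3) by simp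
  then have "CHAR('a) dvd p" using prime_dvd_power CHAR_prime by blast
  then have p: "p = CHAR('a)" using assms(1) CHAR_prime primes_dvd_imp_eq by metis
  have "1 < p" using assms(1) by (rule prime_gt_1_nat)
  \<comment> \<open>Powers of \<open>p > 1\<close> are injective in the exponent, so the least
    exponent is the given one.\<close>
  then have "(LEAST h. p ^ g = p ^ h) = g" by (intro Least_equality) simp_all
  then have g: "g = field_exponent TYPE('a)"
    unfolding field_exponent_def assms(3) p[symmetric] by (rule HOL.sym)
  have "CARD('a) = CHAR('a) ^ field_exponent TYPE('a)" using assms(3) by (simp add: p g)
  from JH_computable_calc[OF this] show ?thesis
    using K0_identities[where 'a = 'a] unfolding p g by blast
qed

end
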